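(* Let $\mathfrak n$ be a $2$-step nilpotent real Lie algebra of dimension $4$ equipped with a scalar product, and let $N$ be the simply connected Lie group with Lie algebra $\mathfrak n$, endowed with the corresponding left-invariant metric. If $F$ is a left-invariant Lorentz force on $N$ of rank $2$, then the corresponding magnetic flow on $N$ is completely integrable.
   Context: A Lie algebra $\mathfrak n$ is 2-step nilpotent if $[U,[V,W]]=0$ for all $U,V,W\in\mathfrak n$. A Lorentz force on a Riemannian manifold $(M,g)$ is a skew-symmetric endomorphism $F$ of $TM$ such that $\omega^F(X,Y):=g(FX,Y)$ is a closed 2-form; on a Lie group it is left-invariant if it is invariant under left translations. A magnetic geodesic is a curve $\gamma$ with $\nabla_{\gamma'}\gamma'=F\gamma'$ ($\nabla$ the Levi-Civita connection); a first integral of the magnetic flow is a differentiable function $\Psi:TM\to\mathbb{R}$ with $\Psi(\gamma')$ constant for every magnetic geodesic $\gamma$. Let $\eta_v(U)=g(v,\pi_*U)$ be the tautological 1-form on $TM$ ($\pi:TM\to M$ the projection), $\Omega^F=-d\eta+\pi^*\omega^F$, define $X_\phi$ by $\Omega^F(X_\phi,U)=U(\phi)$, and $\{\phi_1,\phi_2\}^F=\Omega^F(X_{\phi_1},X_{\phi_2})$. The magnetic flow on $(M,g)$ of dimension $n$ is completely integrable if there are $n-1$ first integrals $\Psi_1,\dots,\Psi_{n-1}:TM\to\mathbb{R}$ with $\{\Psi_i,\Psi_j\}^F=0$ for all $i,j$ and such that the gradients of $\mathrm{E},\Psi_1,\dots,\Psi_{n-1}$ are linearly independent on a dense subset of $TM$,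 where $\mathrm{E}(v)=\frac12g(v,v)$. *)

theory Defs
  imports "HOL-Analysis.Analysis"
begin

text \<open>
  Manifolds here are diffeomorphic to a Euclidean space and are described in one global chart:
  the manifold is the whole type \<open>'a\<close>, its tangent bundle is \<open>'a \<times> 'a\<close> with projection \<open>fst\<close>
  (so \<open>\<pi>\<^sub>* U = fst U\<close>), vector fields are maps \<open>'a \<Rightarrow> 'a\<close>, and tensors are point-dependent
  multilinear maps.  This covers every simply connected nilpotent Lie group, since such a group
  is diffeomorphic to its Lie algebra.
\<close>

abbreviation differential ::
    "('a::real_normed_vector \<Rightarrow> 'b::real_normed_vector) \<Rightarrow> 'a \<Rightarrow> 'a \<Rightarrow> 'b"
  where "differential f p \<equiv> frechet_derivative f (at p)"

primrec C_diff :: "nat \<Rightarrow> ('a::euclidean_space \<Rightarrow> 'b::real_normed_vector) \<Rightarrow> bool" where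
  "C_diff 0 f = continuous_on UNIV f"
| "C_diff (Suc k) f \<longleftrightarrow>
     (\<forall>p. f differentiable (at p)) \<and> (\<forall>h. C_diff k (\<lambda>p. differential f p h))"

definition smooth :: "('a::euclidean_space \<Rightarrow> 'b::real_normed_vector) \<Rightarrow> bool" where
  "smooth f \<longleftrightarrow> (\<forall>k. C_diff k f)"


section \<open>Lie algebras and Lie groups\<close>

definition lie_algebra :: "('a::real_vector \<Rightarrow> 'a \<Rightarrow> 'a) \<Rightarrow> bool" where
  "lie_algebra br \<longleftrightarrow> bilinear br \<and> (\<forall>u. br u u = 0) \<and>
     (\<forall>u v w. br u (br v w) + br v (br w u) + br w (br u v) = 0)"

definition two_step_nilpotent :: "('a::real_vector \<Rightarrow> 'a \<Rightarrow> 'a) \<Rightarrow> bool" where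
  "two_step_nilpotent br \<longleftrightarrow> (\<forall>u v w. br u (br v w) = 0)"

definition lie_group ::
    "('a::euclidean_space \<Rightarrow> 'a \<Rightarrow> 'a) \<Rightarrow> 'a \<Rightarrow> ('a \<Rightarrow> 'a) \<Rightarrow> bool" where
  "lie_group mul e ginv \<longleftrightarrow>
     group mul e ginv \<and> smooth (\<lambda>(x, y). mul x y) \<and> smooth ginv"

definition left_invariant_field ::
    "('a::euclidean_space \<Rightarrow> 'a \<Rightarrow> 'a) \<Rightarrow> 'a \<Rightarrow> 'a \<Rightarrow> ('a \<Rightarrow> 'a)" where
  "left_invariant_field mul e u = (\<lambda>p. differential (mul p) e u)"

definition bracket_of_fields :: "('a::euclidean_space \<Rightarrow> 'a) \<Rightarrow> ('a \<Rightarrow> 'a) \<Rightarrow> ('a \<Rightarrow> 'a)" where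
  "bracket_of_fields X Y = (\<lambda>p. differential Y p (X p) - differential X p (Y p))"

text \<open>The tangent space at \<open>e\<close> is identified with the left-invariant vector fields.\<close>

definition lie_algebra_of ::
    "('a::euclidean_space \<Rightarrow> 'a \<Rightarrow> 'a) \<Rightarrow> 'a \<Rightarrow> 'a \<Rightarrow> 'a \<Rightarrow> 'a" where
  "lie_algebra_of mul e u v =
     bracket_of_fields (left_invariant_field mul e u) (left_invariant_field mul e v) e"

text \<open>
  The left-invariant metric whose value on the tangent space at the identity is the inner
  product of the type: tangent vectors at \<open>p\<close> are moved to the identity by left translation
  with the inverse of \<open>p\<close>.
\<close>

definition left_invariant_metric ::
    "('a::euclidean_space \<Rightarrow> 'a \<Rightarrow> 'a) \<Rightarrow> ('a \<Rightarrow> 'a) \<Rightarrow> 'a \<Rightarrow> 'a \<Rightarrow> 'a \<Rightarrow> real" where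
  "left_invariant_metric mul ginv p u v =
     inner (differential (mul (ginv p)) p u) (differential (mul (ginv p)) p v)"

definition left_invariant_endomorphism ::
    "('a::euclidean_space \<Rightarrow> 'a \<Rightarrow> 'a) \<Rightarrow> ('a \<Rightarrow> 'a \<Rightarrow> 'a) \<Rightarrow> bool" where
  "left_invariant_endomorphism mul F \<longleftrightarrow>
     (\<forall>a p u. differential (mul a) p (F p u) = F (mul a p) (differential (mul a) p u))"


section \<open>Lorentz forces and magnetic geodesics\<close>

definition exterior_derivative1 ::
    "('a::real_normed_vector \<Rightarrow> 'a \<Rightarrow> real) \<Rightarrow> 'a \<Rightarrow> 'a \<Rightarrow> 'a \<Rightarrow> real" where
  "exterior_derivative1 \<alpha> p u v =
     differential (\<lambda>q. \<alpha> q v) p u - differential (\<lambda>q. \<alpha> q u) p v"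

definition exterior_derivative2 ::
    "('a::real_normed_vector \<Rightarrow> 'a \<Rightarrow> 'a \<Rightarrow> real) \<Rightarrow> 'a \<Rightarrow> 'a \<Rightarrow> 'a \<Rightarrow> 'a \<Rightarrow> real" where
  "exterior_derivative2 \<omega> p u v w =
     differential (\<lambda>q. \<omega> q v w) p u - differential (\<lambda>q. \<omega> q u w) p v
       + differential (\<lambda>q. \<omega> q u v) p w"

definition lorentz_force ::
    "('a::euclidean_space \<Rightarrow> 'a \<Rightarrow> 'a \<Rightarrow> real) \<Rightarrow> ('a \<Rightarrow> 'a \<Rightarrow> 'a) \<Rightarrow> bool" where
  "lorentz_force g F \<longleftrightarrow>
     (\<forall>p. linear (F p)) \<and> (\<forall>u. smooth (\<lambda>p. F p u)) \<and>
     (\<forall>p u v. g p (F p u) v = - g p u (F p v)) \<and>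
     (\<forall>p u v w. exterior_derivative2 (\<lambda>q x y. g q (F q x) y) p u v w = 0)"

text \<open>
  In the global chart an affine connection is \<open>\<nabla>\<^sub>X Y = DY(X) + \<Gamma>(X, Y)\<close>.  The Levi-Civita
  connection is the one that is torsion-free (\<open>\<Gamma>\<close> symmetric) and compatible with the metric.
\<close>

definition levi_civita ::
    "('a::euclidean_space \<Rightarrow> 'a \<Rightarrow> 'a \<Rightarrow> real) \<Rightarrow> 'a \<Rightarrow> 'a \<Rightarrow> 'a \<Rightarrow> 'a" where
  "levi_civita g = (THE \<Gamma>.
     (\<forall>p. bilinear (\<Gamma> p)) \<and>
     (\<forall>p u v. \<Gamma> p u v = \<Gamma> p v u) \<and>
     (\<forall>p u v w. differential (\<lambda>q. g q v w) p u = g p (\<Gamma> p u v) w + g p v (\<Gamma> p u w)))"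

definition velocity :: "(real \<Rightarrow> 'a::real_normed_vector) \<Rightarrow> real \<Rightarrow> 'a" where
  "velocity \<gamma> t = vector_derivative \<gamma> (at t)"

definition magnetic_geodesic ::
    "('a::euclidean_space \<Rightarrow> 'a \<Rightarrow> 'a \<Rightarrow> real) \<Rightarrow> ('a \<Rightarrow> 'a \<Rightarrow> 'a) \<Rightarrow> real set \<Rightarrow>
      (real \<Rightarrow> 'a) \<Rightarrow> bool" where
  "magnetic_geodesic g F I \<gamma> \<longleftrightarrow>
     open I \<and> is_interval I \<and>
     (\<forall>t\<in>I. \<gamma> differentiable (at t)) \<and> (\<forall>t\<in>I. velocity \<gamma> differentiable (at t)) \<and>
     (\<forall>t\<in>I. vector_derivative (velocity \<gamma>) (at t)
               + levi_civita g (\<gamma> t) (velocity \<gamma> t) (velocity \<gamma> t)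
             = F (\<gamma> t) (velocity \<gamma> t))"

definition first_integral ::
    "('a::euclidean_space \<Rightarrow> 'a \<Rightarrow> 'a \<Rightarrow> real) \<Rightarrow> ('a \<Rightarrow> 'a \<Rightarrow> 'a) \<Rightarrow>
      ('a \<times> 'a \<Rightarrow> real) \<Rightarrow> bool" where
  "first_integral g F \<Psi> \<longleftrightarrow>
     (\<forall>v. \<Psi> differentiable (at v)) \<and>
     (\<forall>I \<gamma>. magnetic_geodesic g F I \<gamma> \<longrightarrow> (\<lambda>t. \<Psi> (\<gamma> t, velocity \<gamma> t)) constant_on I)"


section \<open>The symplectic structure of the tangent bundle and integrability\<close>

definition tautological_form ::
    "('a::euclidean_space \<Rightarrow> 'a \<Rightarrow> 'a \<Rightarrow> real) \<Rightarrow> 'a \<times> 'a \<Rightarrow> 'a \<times> 'a \<Rightarrow> real" where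
  "tautological_form g v U = g (fst v) (snd v) (fst U)"

definition magnetic_form ::
    "('a::euclidean_space \<Rightarrow> 'a \<Rightarrow> 'a \<Rightarrow> real) \<Rightarrow> ('a \<Rightarrow> 'a \<Rightarrow> 'a) \<Rightarrow>
      'a \<times> 'a \<Rightarrow> 'a \<times> 'a \<Rightarrow> 'a \<times> 'a \<Rightarrow> real" where
  "magnetic_form g F v U W =
     - exterior_derivative1 (tautological_form g) v U W
     + g (fst v) (F (fst v) (fst U)) (fst W)"

definition hamiltonian_field ::
    "('a::euclidean_space \<Rightarrow> 'a \<Rightarrow> 'a \<Rightarrow> real) \<Rightarrow> ('a \<Rightarrow> 'a \<Rightarrow> 'a) \<Rightarrow>
      ('a \<times> 'a \<Rightarrow> real) \<Rightarrow> 'a \<times> 'a \<Rightarrow> 'a \<times> 'a" where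
  "hamiltonian_field g F \<phi> v = (THE X. \<forall>U. magnetic_form g F v X U = differential \<phi> v U)"

definition magnetic_poisson ::
    "('a::euclidean_space \<Rightarrow> 'a \<Rightarrow> 'a \<Rightarrow> real) \<Rightarrow> ('a \<Rightarrow> 'a \<Rightarrow> 'a) \<Rightarrow>
      ('a \<times> 'a \<Rightarrow> real) \<Rightarrow> ('a \<times> 'a \<Rightarrow> real) \<Rightarrow> 'a \<times> 'a \<Rightarrow> real" where
  "magnetic_poisson g F \<phi> \<psi> v =
     magnetic_form g F v (hamiltonian_field g F \<phi> v) (hamiltonian_field g F \<psi> v)"

text \<open>
  Gradients on the tangent bundle are taken with respect to the Sasaki metric; the second
  summand uses the vertical part \<open>snd U + \<Gamma>(fst U, v)\<close> of \<open>U\<close>.  Linear independence of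
  gradients does not depend on the choice of the metric.
\<close>

definition sasaki_metric ::
    "('a::euclidean_space \<Rightarrow> 'a \<Rightarrow> 'a \<Rightarrow> real) \<Rightarrow>
      'a \<times> 'a \<Rightarrow> 'a \<times> 'a \<Rightarrow> 'a \<times> 'a \<Rightarrow> real" where
  "sasaki_metric g v U W =
     g (fst v) (fst U) (fst W)
     + g (fst v) (snd U + levi_civita g (fst v) (fst U) (snd v))
                 (snd W + levi_civita g (fst v) (fst W) (snd v))"

definition gradient ::
    "('m::euclidean_space \<Rightarrow> 'm \<Rightarrow> 'm \<Rightarrow> real) \<Rightarrow> ('m \<Rightarrow> real) \<Rightarrow> 'm \<Rightarrow> 'm" where
  "gradient G \<phi> v = (THE X. \<forall>U. G v X U = differential \<phi> v U)"

definition energy ::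
    "('a::euclidean_space \<Rightarrow> 'a \<Rightarrow> 'a \<Rightarrow> real) \<Rightarrow> 'a \<times> 'a \<Rightarrow> real" where
  "energy g v = 1 / 2 * g (fst v) (snd v) (snd v)"

text \<open>
  Index \<open>0\<close> of the family of gradients is the energy.  The injectivity clause makes
  \<^const>\<open>independent\<close>, which speaks about sets, express independence of the family.
\<close>

definition completely_integrable ::
    "('a::euclidean_space \<Rightarrow> 'a \<Rightarrow> 'a \<Rightarrow> real) \<Rightarrow> ('a \<Rightarrow> 'a \<Rightarrow> 'a) \<Rightarrow> bool" where
  "completely_integrable g F \<longleftrightarrow>
     (\<exists>\<Psi> :: nat \<Rightarrow> 'a \<times> 'a \<Rightarrow> real.
        (\<forall>i\<in>{1..DIM('a) - 1}. first_integral g F (\<Psi> i)) \<and>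
        (\<forall>i\<in>{1..DIM('a) - 1}. \<forall>j\<in>{1..DIM('a) - 1}. \<forall>v.
            magnetic_poisson g F (\<Psi> i) (\<Psi> j) v = 0) \<and>
        (\<exists>D. closure D = UNIV \<and>
           (\<forall>v\<in>D.
              let grad = (\<lambda>i. gradient (sasaki_metric g) (if i = 0 then energy g else \<Psi> i) v)
              in inj_on grad {0..DIM('a) - 1} \<and> independent (grad ` {0..DIM('a) - 1}))))"


section \<open>Existence of the group\<close>

lemma C_diff_const: "C_diff k (\<lambda>p. c)"
  by (induction k arbitrary: c) (simp_all add: frechet_derivative_const)

lemma C_diff_affine:
  assumes "bounded_linear L"
  shows "C_diff k (\<lambda>p. c + L p)"
proof (cases k)
  case 0
  then show ?thesis
    using continuous_on_add[OF continuous_on_const linear_continuous_on[OF assms]] by simp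
next
  case (Suc j)
  have d: "((\<lambda>p. c + L p) has_derivative L) (at p)" for p
    using bounded_linear_imp_has_derivative[OF assms, of "at p"]
    by (auto intro!: derivative_eq_intros)
  have "differential (\<lambda>p. c + L p) p = L" for p
    by (rule frechet_derivative_at[OF d, symmetric])
  with d show ?thesis
    unfolding Suc by (auto simp: C_diff_const differentiable_def)
qed

text \<open>
  Every 2-step nilpotent Lie algebra is the Lie algebra of a group as above, namely of the one
  with the Baker-Campbell-Hausdorff multiplication.
\<close>

lemma two_step_nilpotent_lie_group:
  fixes br :: "'a::euclidean_space \<Rightarrow> 'a \<Rightarrow> 'a"
  assumes alg: "lie_algebra br" and nil: "two_step_nilpotent br"
  defines "mul \<equiv> (\<lambda>x y. x + y + (1/2) *\<^sub>R br x y)"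
  shows "lie_group mul 0 uminus" and "lie_algebra_of mul 0 = br"
proof -
  have bl: "bilinear br" and alt: "br u u = 0" for u
    using alg by (auto simp: lie_algebra_def)
  have nil1: "br u (br v w) = 0" for u v w
    using nil by (simp add: two_step_nilpotent_def)
  note bs = bilinear_ladd[OF bl] bilinear_radd[OF bl] bilinear_lmul[OF bl] bilinear_rmul[OF bl]
    bilinear_lneg[OF bl] bilinear_rneg[OF bl] bilinear_lzero[OF bl] bilinear_rzero[OF bl]
  have anti: "br u v = - br v u" for u v
    using alt[of "u + v"] alt[of u] alt[of v] by (simp add: bs eq_neg_iff_add_eq_0 add.commute)
  have nil2: "br (br v w) u = 0" for u v w
    using anti[of "br v w" u] nil1 by simp
  have bb: "bounded_bilinear br"
    using bl by (simp add: bilinear_conv_bounded_bilinear)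
  have grp: "group mul 0 uminus"
  proof
    show "mul (mul a b) c = mul a (mul b c)" for a b c
      by (simp add: mul_def bs nil1 nil2 scaleR_add_right)
    show "mul 0 a = a" for a
      by (simp add: mul_def bs)
    show "mul (- a) a = 0" for a
      by (simp add: mul_def bs alt)
  qed
  define L where "L z h = fst h + snd h + (1/2) *\<^sub>R (br (fst z) (snd h) + br (fst h) (snd z))"
    for z h :: "'a \<times> 'a"
  have dm: "((\<lambda>(x, y). mul x y) has_derivative L z) (at z)" for z
    unfolding mul_def L_def case_prod_beta
    by (intro has_derivative_add has_derivative_scaleR_right bounded_bilinear.FDERIV[OF bb]
        has_derivative_fst has_derivative_snd has_derivative_ident)
  have dm': "differential (\<lambda>(x, y). mul x y) z = L z" for z
    by (rule frechet_derivative_at[OF dm, symmetric])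
  have "C_diff k (\<lambda>(x, y). mul x y)" for k
  proof (cases k)
    case 0
    have "continuous_on UNIV (\<lambda>(x, y). mul x y)"
      by (intro continuous_at_imp_continuous_on ballI has_derivative_continuous[OF dm])
    with 0 show ?thesis by simp
  next
    case (Suc j)
    have "C_diff j (\<lambda>z. L z h)" for h
    proof -
      have "linear (\<lambda>z. (1/2) *\<^sub>R (br (fst z) (snd h) + br (fst h) (snd z)))"
        by (rule linearI) (simp_all add: bs algebra_simps)
      then show ?thesis
        unfolding L_def by (intro C_diff_affine) (simp add: linear_conv_bounded_linear)
    qed
    with dm show ?thesis
      unfolding Suc by (auto simp: dm' differentiable_def)
  qed
  moreover have "C_diff k (uminus :: 'a \<Rightarrow> 'a)" for k
    using C_diff_affine[of "uminus :: 'a \<Rightarrow> 'a" k 0] bounded_linear_minus[OF bounded_linear_ident]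
    by simp
  ultimately show "lie_group mul 0 uminus"
    using grp by (simp add: lie_group_def smooth_def)
  have dl: "(mul p has_derivative (\<lambda>u. u + (1/2) *\<^sub>R br p u)) (at q)" for p q
    unfolding mul_def
    by (rule has_derivative_eq_rhs, (rule has_derivative_add has_derivative_scaleR_right
        has_derivative_const has_derivative_ident bounded_bilinear.FDERIV[OF bb])+)
      (simp add: bs)
  have lif: "left_invariant_field mul 0 u = (\<lambda>p. u + (1/2) *\<^sub>R br p u)" for u
    unfolding left_invariant_field_def
    by (rule ext, rule frechet_derivative_at[OF dl, symmetric, THEN fun_cong])
  have df: "((\<lambda>p. u + (1/2) *\<^sub>R br p u) has_derivative (\<lambda>h. (1/2) *\<^sub>R br h u)) (at q)" for u q
    by (rule has_derivative_eq_rhs, (rule has_derivative_add has_derivative_scaleR_right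
        has_derivative_const has_derivative_ident bounded_bilinear.FDERIV[OF bb])+)
      (simp add: bs)
  have dlif: "differential (\<lambda>p. u + (1/2) *\<^sub>R br p u) q = (\<lambda>h. (1/2) *\<^sub>R br h u)" for u q
    by (rule frechet_derivative_at[OF df, symmetric])
  have "(1/2) *\<^sub>R br u v - (1/2) *\<^sub>R br v u = br u v" for u v
    using anti[of v u] by (simp flip: scaleR_add_left)
  then show "lie_algebra_of mul 0 = br"
    by (simp add: fun_eq_iff lie_algebra_of_def bracket_of_fields_def lif dlif bs)
qed

end

theory Submission
  imports Defs
begin

text \<open>
  Left translations of \<open>N\<close> preserve both the metric \<open>g\<close> and the magnetic 2-form
  \<open>\<omega> = g(F \<cdot>, \<cdot>)\<close>, and Noether's principle turns this symmetry into first integrals.  The generators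
  of the left translations are the right-invariant fields \<open>R\<^sub>u\<close>.  Each is a Killing field that
  preserves \<open>\<omega>\<close>, so the 1-form \<open>\<omega>(R\<^sub>u, \<cdot>)\<close> is closed, and on the chart it is the differential of a
  function \<open>f\<^sub>u\<close>.  Then \<open>\<Psi>\<^sub>u(p, s) = g\<^sub>p(s, R\<^sub>u(p)) + f\<^sub>u(p)\<close> is a first integral, its Hamiltonian
  field is the natural lift \<open>(R\<^sub>u, DR\<^sub>u(s))\<close> of \<open>R\<^sub>u\<close> to the tangent bundle, and
  \<open>{\<Psi>\<^sub>u, \<Psi>\<^sub>v}(p, s) = g\<^sub>p(s, [R\<^sub>v, R\<^sub>u]) + \<omega>\<^sub>p(R\<^sub>u, R\<^sub>v)\<close>.  When \<open>[u, v] = 0\<close> the first term vanishes and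
  the second is constant on \<open>N\<close>, equal to \<open>\<omega>\<^sub>e(u, v)\<close>.

  Hence \<open>n - 1\<close> linearly independent vectors of the Lie algebra that commute pairwise and are
  pairwise \<open>\<omega>\<^sub>e\<close>-orthogonal yield \<open>n - 1\<close> first integrals in involution
  (\<open>isotropic_abelian_hyperplane_integrable\<close>).  Their independence from the energy is visible on the
  fibres: along vertical directions the differentials of \<open>E, \<Psi>\<^sub>1, \<dots>, \<Psi>\<^sub>n\<^sub>-\<^sub>1\<close> at \<open>(p, s)\<close> are the
  \<open>g\<close>-products with \<open>s, R\<^sub>1(p), \<dots>, R\<^sub>n\<^sub>-\<^sub>1(p)\<close>, so the gradients are independent as soon as \<open>s\<close> lies
  outside the hyperplane spanned by the \<open>R\<^sub>i(p)\<close>.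

  What remains is linear algebra in dimension four (\<open>exists_isotropic_abelian_hyperplane\<close>).  The
  kernel \<open>K\<close> of a skew map of rank 2 is a plane, which together with any vector
  outside it spans an \<open>\<omega>\<^sub>e\<close>-isotropic hyperplane.  Since \<open>\<omega>\<close> is closed, \<open>\<omega>\<^sub>e\<close> is a 2-cocycle and \<open>K\<close> is a subalgebra,
  which is abelian because the Lie algebra is nilpotent.  Finally, 2-step nilpotency and a count of
  dimensions give a vector outside \<open>K\<close> that commutes with \<open>K\<close>.
\<close>

section \<open>Calculus in several variables\<close>

lemma has_derivative_differential:
  assumes "f differentiable (at p)"
  shows "(f has_derivative differential f p) (at p)"
  using assms frechet_derivative_works by blast

lemma differential_eqI:
  assumes "(f has_derivative f') (at p)"
  shows "differential f p = f'"
  using frechet_derivative_at[OF assms] by simp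

lemma has_derivative_along_line:
  assumes "(f has_derivative f') (at (a + t *\<^sub>R h))"
  shows "((\<lambda>t. f (a + t *\<^sub>R h)) has_derivative (\<lambda>s. s *\<^sub>R f' h)) (at t)"
proof -
  have "((\<lambda>t. a + t *\<^sub>R h) has_derivative (\<lambda>s. s *\<^sub>R h)) (at t)"
    by (auto intro!: derivative_eq_intros)
  from has_derivative_compose[OF this assms]
  have "((\<lambda>t. f (a + t *\<^sub>R h)) has_derivative (\<lambda>s. f' (s *\<^sub>R h))) (at t)" .
  then show ?thesis
    using linear_scale[OF has_derivative_linear[OF assms]] by simp
qed

lemma has_real_derivative_along_line:
  fixes f :: "'a::real_normed_vector \<Rightarrow> real"
  assumes "(f has_derivative f') (at (a + t *\<^sub>R h))"
  shows "((\<lambda>t. f (a + t *\<^sub>R h)) has_real_derivative f' h) (at t)"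
  using has_derivative_along_line[OF assms]
  by (simp add: has_field_derivative_def mult.commute mult_commute_abs)

text \<open>
  The mean value theorem, used once along \<open>h\<close> and once along \<open>k\<close>.  The left-hand side is
  symmetric in \<open>h\<close> and \<open>k\<close> while the right-hand side is not; this is what makes second
  derivatives symmetric.
\<close>

lemma second_difference_mean_value:
  fixes f :: "'a::real_normed_vector \<Rightarrow> real"
  assumes D: "\<And>z. (f has_derivative D z) (at z)"
    and D2: "\<And>z. ((\<lambda>z. D z h) has_derivative D2 z) (at z)"
    and t: "0 < t"
  shows "\<exists>\<xi> \<eta>. \<xi> \<in> {0<..<t} \<and> \<eta> \<in> {0<..<t} \<and>
    f (z + t *\<^sub>R h + t *\<^sub>R k) - f (z + t *\<^sub>R h) - f (z + t *\<^sub>R k) + f z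
      = t * t * D2 (z + \<xi> *\<^sub>R h + \<eta> *\<^sub>R k) k"
proof -
  have "((\<lambda>s. f ((z + t *\<^sub>R k) + s *\<^sub>R h) - f (z + s *\<^sub>R h)) has_real_derivative
      D ((z + t *\<^sub>R k) + s *\<^sub>R h) h - D (z + s *\<^sub>R h) h) (at s)" for s
    by (intro DERIV_diff has_real_derivative_along_line D)
  from MVT2[OF t this] obtain \<xi> where \<xi>: "0 < \<xi>" "\<xi> < t" and
    1: "f ((z + t *\<^sub>R k) + t *\<^sub>R h) - f (z + t *\<^sub>R h) - (f ((z + t *\<^sub>R k) + 0 *\<^sub>R h) - f (z + 0 *\<^sub>R h))
      = (t - 0) * (D ((z + t *\<^sub>R k) + \<xi> *\<^sub>R h) h - D (z + \<xi> *\<^sub>R h) h)"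
    by blast
  have "((\<lambda>s. D ((z + \<xi> *\<^sub>R h) + s *\<^sub>R k) h) has_real_derivative D2 ((z + \<xi> *\<^sub>R h) + s *\<^sub>R k) k) (at s)" for s
    by (intro has_real_derivative_along_line D2)
  from MVT2[OF t this] obtain \<eta> where \<eta>: "0 < \<eta>" "\<eta> < t" and
    2: "D ((z + \<xi> *\<^sub>R h) + t *\<^sub>R k) h - D ((z + \<xi> *\<^sub>R h) + 0 *\<^sub>R k) h
      = (t - 0) * D2 ((z + \<xi> *\<^sub>R h) + \<eta> *\<^sub>R k) k"
    by blast
  show ?thesis
    using \<xi> \<eta> 1 2 by (intro exI[of _ \<xi>] exI[of _ \<eta>]) (simp add: algebra_simps)
qed

lemma second_derivative_symmetric_real:
  fixes f :: "'a::real_normed_vector \<Rightarrow> real"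
  assumes D: "\<And>z. (f has_derivative D z) (at z)"
    and D2h: "\<And>z. ((\<lambda>z. D z h) has_derivative D2h z) (at z)"
    and D2k: "\<And>z. ((\<lambda>z. D z k) has_derivative D2k z) (at z)"
    and ch: "isCont (\<lambda>z. D2h z k) z" and ck: "isCont (\<lambda>z. D2k z h) z"
  shows "D2h z k = D2k z h"
proof (rule ccontr)
  assume ne: "D2h z k \<noteq> D2k z h"
  define \<epsilon> where "\<epsilon> = \<bar>D2h z k - D2k z h\<bar> / 2"
  have \<epsilon>: "\<epsilon> > 0" using ne by (simp add: \<epsilon>_def)
  obtain d1 where d1: "d1 > 0" "\<And>w. dist w z < d1 \<Longrightarrow> dist (D2h w k) (D2h z k) < \<epsilon>"
    using ch \<epsilon> unfolding continuous_at_eps_delta by meson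
  obtain d2 where d2: "d2 > 0" "\<And>w. dist w z < d2 \<Longrightarrow> dist (D2k w h) (D2k z h) < \<epsilon>"
    using ck \<epsilon> unfolding continuous_at_eps_delta by meson
  \<comment> \<open>so small that the parallelogram with sides \<open>t *\<^sub>R h\<close> and \<open>t *\<^sub>R k\<close> lies in both neighbourhoods\<close>
  define t where "t = min d1 d2 / (norm h + norm k + 1)"
  have pos: "norm h + norm k + 1 > 0" by (simp add: add_nonneg_pos)
  have t: "t > 0" using d1(1) d2(1) pos by (simp add: t_def)
  have close: "dist (z + \<xi> *\<^sub>R a + \<eta> *\<^sub>R b) z < min d1 d2"
    if "\<xi> \<in> {0<..<t}" "\<eta> \<in> {0<..<t}" "norm a + norm b = norm h + norm k" for \<xi> \<eta> a b
  proof -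
    have "dist (z + \<xi> *\<^sub>R a + \<eta> *\<^sub>R b) z = norm (\<xi> *\<^sub>R a + \<eta> *\<^sub>R b)"
      by (simp add: dist_norm add.assoc)
    also have "\<dots> \<le> \<xi> * norm a + \<eta> * norm b"
      using norm_triangle_ineq[of "\<xi> *\<^sub>R a" "\<eta> *\<^sub>R b"] that by simp
    also have "\<dots> \<le> t * norm a + t * norm b"
      using that by (intro add_mono mult_right_mono) auto
    also have "\<dots> = t * (norm h + norm k)" using that(3) by (simp flip: distrib_left)
    also have "\<dots> < t * (norm h + norm k + 1)" using t by simp
    also have "\<dots> = min d1 d2" using pos by (simp add: t_def)
    finally show ?thesis .
  qed
  obtain \<xi> \<eta> where 1: "\<xi> \<in> {0<..<t}" "\<eta> \<in> {0<..<t}"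
    "f (z + t *\<^sub>R h + t *\<^sub>R k) - f (z + t *\<^sub>R h) - f (z + t *\<^sub>R k) + f z
      = t * t * D2h (z + \<xi> *\<^sub>R h + \<eta> *\<^sub>R k) k"
    using second_difference_mean_value[OF D D2h t] by blast
  obtain \<xi>' \<eta>' where 2: "\<xi>' \<in> {0<..<t}" "\<eta>' \<in> {0<..<t}"
    "f (z + t *\<^sub>R k + t *\<^sub>R h) - f (z + t *\<^sub>R k) - f (z + t *\<^sub>R h) + f z
      = t * t * D2k (z + \<xi>' *\<^sub>R k + \<eta>' *\<^sub>R h) h"
    using second_difference_mean_value[OF D D2k t] by blast
  have "t * t * D2h (z + \<xi> *\<^sub>R h + \<eta> *\<^sub>R k) k = t * t * D2k (z + \<xi>' *\<^sub>R k + \<eta>' *\<^sub>R h) h"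
    using 1(3) 2(3) by (simp add: algebra_simps)
  then have "D2h (z + \<xi> *\<^sub>R h + \<eta> *\<^sub>R k) k = D2k (z + \<xi>' *\<^sub>R k + \<eta>' *\<^sub>R h) h"
    using t by simp
  moreover have "dist (D2h (z + \<xi> *\<^sub>R h + \<eta> *\<^sub>R k) k) (D2h z k) < \<epsilon>"
    using close[OF 1(1,2)] d1(2) by simp
  moreover have "dist (D2k (z + \<xi>' *\<^sub>R k + \<eta>' *\<^sub>R h) h) (D2k z h) < \<epsilon>"
    using close[OF 2(1,2)] d2(2) by simp
  ultimately have "dist (D2h z k) (D2k z h) < 2 * \<epsilon>"
    using dist_triangle3[of "D2h z k" "D2k z h" "D2h (z + \<xi> *\<^sub>R h + \<eta> *\<^sub>R k) k"] by simp
  then show False by (simp add: \<epsilon>_def dist_real_def)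
qed

lemma second_derivative_symmetric:
  fixes f :: "'a::real_normed_vector \<Rightarrow> 'b::euclidean_space"
  assumes D: "\<And>z. (f has_derivative D z) (at z)"
    and D2: "\<And>z h. ((\<lambda>z. D z h) has_derivative D2 z h) (at z)"
    and cont: "\<And>h k. continuous_on UNIV (\<lambda>z. D2 z h k)"
  shows "D2 z h k = D2 z k h"
proof (rule euclidean_eqI)
  fix b :: 'b
  have c: "isCont (\<lambda>z. D2 z h k \<bullet> b) z" for h k z
    using cont[of h k] by (auto simp: continuous_on_eq_continuous_at intro!: continuous_intros)
  show "D2 z h k \<bullet> b = D2 z k h \<bullet> b"
    by (rule second_derivative_symmetric_real[where f="\<lambda>z. f z \<bullet> b" and D="\<lambda>z h. D z h \<bullet> b"])
       (intro has_derivative_inner_left D D2 c)+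
qed

lemma linear_expansion:
  fixes T :: "'a::euclidean_space \<Rightarrow> 'b::real_vector"
  assumes "linear T"
  shows "T x = (\<Sum>b\<in>Basis. (x \<bullet> b) *\<^sub>R T b)"
  by (subst (1) euclidean_representation[of x, symmetric])
     (simp only: linear_sum[OF assms] linear_scale[OF assms] o_def)

text \<open>
  Metrics, forms and translations are point-dependent linear maps \<open>T q\<close> that are known to be
  differentiable only for each fixed argument.  The next lemmas extend this to arguments that move
  with the point, by expanding the argument in the standard basis.
\<close>

lemma linear_family_derivative_linear:
  assumes lin: "\<And>q. linear (T q)"
    and der: "\<And>x. ((\<lambda>q. T q x) has_derivative (\<lambda>h. T' h x)) (at p)"
  shows "linear (T' h)"
proof (rule linearI)
  fix x y and c :: real
  have "((\<lambda>q. T q (x + y)) has_derivative (\<lambda>h. T' h x + T' h y)) (at p)"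
    using has_derivative_add[OF der der] by (simp add: linear_add[OF lin])
  from fun_cong[OF has_derivative_unique[OF der this], of h]
  show "T' h (x + y) = T' h x + T' h y" .
  have "((\<lambda>q. T q (c *\<^sub>R x)) has_derivative (\<lambda>h. c *\<^sub>R T' h x)) (at p)"
    using has_derivative_scaleR_right[OF der] by (simp add: linear_scale[OF lin])
  from fun_cong[OF has_derivative_unique[OF der this], of h]
  show "T' h (c *\<^sub>R x) = c *\<^sub>R T' h x" .
qed

lemma has_derivative_linear_family:
  fixes T :: "'p::real_normed_vector \<Rightarrow> 'a::euclidean_space \<Rightarrow> 'b::real_normed_vector"
  assumes lin: "\<And>q. linear (T q)"
    and der: "\<And>x. ((\<lambda>q. T q x) has_derivative (\<lambda>h. T' h x)) (at (c z))"
    and c: "(c has_derivative c') (at z)"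
    and Y: "(Y has_derivative Y') (at z)"
  shows "((\<lambda>z. T (c z) (Y z)) has_derivative (\<lambda>h. T' (c' h) (Y z) + T (c z) (Y' h))) (at z)"
proof -
  have lin': "linear (T' h)" for h
    by (rule linear_family_derivative_linear[OF lin der])
  have "((\<lambda>z. \<Sum>b\<in>Basis. (Y z \<bullet> b) *\<^sub>R T (c z) b) has_derivative
     (\<lambda>h. \<Sum>b\<in>Basis. (Y z \<bullet> b) *\<^sub>R T' (c' h) b + (Y' h \<bullet> b) *\<^sub>R T (c z) b)) (at z)"
    by (intro has_derivative_sum has_derivative_scaleR has_derivative_inner_left Y
        has_derivative_compose[OF c der])
  then show ?thesis
    by (simp only: sum.distrib linear_expansion[OF lin, symmetric] linear_expansion[OF lin', symmetric])
qed

lemma continuous_on_linear_family: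
  fixes T :: "'p::topological_space \<Rightarrow> 'a::euclidean_space \<Rightarrow> 'b::real_normed_vector"
  assumes lin: "\<And>q. linear (T q)"
    and cont: "\<And>x. continuous_on S (\<lambda>q. T q x)"
    and Y: "continuous_on S Y"
  shows "continuous_on S (\<lambda>q. T q (Y q))"
proof -
  have "continuous_on S (\<lambda>q. \<Sum>b\<in>Basis. (Y q \<bullet> b) *\<^sub>R T q b)"
    by (intro continuous_intros Y cont)
  then show ?thesis by (simp only: linear_expansion[OF lin, symmetric])
qed

lemma has_derivative_bilinear_family:
  fixes \<beta> :: "'p::real_normed_vector \<Rightarrow> 'a::euclidean_space \<Rightarrow> 'b::euclidean_space \<Rightarrow> 'c::real_normed_vector"
  assumes bil: "\<And>q. bilinear (\<beta> q)"
    and der: "\<And>x y. ((\<lambda>q. \<beta> q x y) has_derivative (\<lambda>h. \<beta>' h x y)) (at (c z))"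
    and c: "(c has_derivative c') (at z)"
    and X: "(X has_derivative X') (at z)"
    and Y: "(Y has_derivative Y') (at z)"
  shows "((\<lambda>z. \<beta> (c z) (X z) (Y z)) has_derivative
    (\<lambda>h. \<beta>' (c' h) (X z) (Y z) + \<beta> (c z) (X' h) (Y z) + \<beta> (c z) (X z) (Y' h))) (at z)"
proof (rule has_derivative_linear_family[where c = "\<lambda>z. z" and c' = "\<lambda>h. h"
      and T' = "\<lambda>h y. \<beta>' (c' h) (X z) y + \<beta> (c z) (X' h) y" and T = "\<lambda>z y. \<beta> (c z) (X z) y"])
  show "linear (\<beta> (c z) (X z))" for z
    using bil by (simp add: bilinear_def)
  show "((\<lambda>q. \<beta> (c q) (X q) y) has_derivative (\<lambda>h. \<beta>' (c' h) (X z) y + \<beta> (c z) (X' h) y)) (at z)" for y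
    by (rule has_derivative_linear_family[where T="\<lambda>q x. \<beta> q x y" and T'="\<lambda>h x. \<beta>' h x y", OF _ der c X])
       (use bil in \<open>simp add: bilinear_def\<close>)
qed (use Y in auto)

text \<open>
  Poincare's lemma for 1-forms on the whole space.  The primitive is the integral of \<open>\<alpha>\<close> along
  the ray from the origin; closedness turns the derivative of the integrand in direction \<open>h\<close> into
  \<open>d/dt (t \<alpha>(t p) h)\<close>.
\<close>

lemma closed_one_form_exact:
  fixes \<alpha> :: "'a::euclidean_space \<Rightarrow> 'a \<Rightarrow> real"
  assumes lin: "\<And>p. linear (\<alpha> p)"
    and der: "\<And>p w. ((\<lambda>q. \<alpha> q w) has_derivative (\<lambda>h. \<alpha>' p h w)) (at p)"
    and cont: "\<And>h w. continuous_on UNIV (\<lambda>p. \<alpha>' p h w)"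
    and closed: "\<And>p h w. \<alpha>' p h w = \<alpha>' p w h"
  obtains f where "\<And>p. (f has_derivative \<alpha> p) (at p)"
proof -
  have ray: "((\<lambda>p. t *\<^sub>R p) has_derivative (\<lambda>h. t *\<^sub>R h)) (at p)" for t and p :: 'a
    by (auto intro!: derivative_eq_intros)
  have lin1: "linear (\<lambda>h. \<alpha>' p h w)" for p w
    using has_derivative_linear[OF der] .
  have lin2: "linear (\<alpha>' p h)" for p h
    by (rule linear_family_derivative_linear[OF lin der])
  define G where "G p t = Blinfun (\<lambda>h. t * \<alpha>' (t *\<^sub>R p) h p + \<alpha> (t *\<^sub>R p) h)" for p t
  have int: "((\<lambda>p. \<alpha> (t *\<^sub>R p) p) has_derivative (\<lambda>h. t * \<alpha>' (t *\<^sub>R p) h p + \<alpha> (t *\<^sub>R p) h)) (at p)" for p t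
    using has_derivative_linear_family[OF lin der ray has_derivative_ident]
    by (simp add: linear_scale[OF lin1])
  have G: "blinfun_apply (G p t) = (\<lambda>h. t * \<alpha>' (t *\<^sub>R p) h p + \<alpha> (t *\<^sub>R p) h)" for p t
    unfolding G_def using has_derivative_bounded_linear[OF int] by (rule bounded_linear_Blinfun_apply)
  have c0: "continuous_on UNIV (\<lambda>q. \<alpha> q w)" for w
    by (intro continuous_at_imp_continuous_on ballI has_derivative_continuous[OF der])
  have c1: "continuous_on S (\<lambda>z. \<alpha> (c z) (Y z))" if "continuous_on S c" "continuous_on S Y"
    for S and c Y :: "'z::topological_space \<Rightarrow> 'a"
    by (rule continuous_on_linear_family[OF lin _ that(2)])
       (rule continuous_on_compose2[OF c0 that(1)], simp)
  have c2: "continuous_on S (\<lambda>z. \<alpha>' (c z) h (Y z))" if "continuous_on S c" "continuous_on S Y"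
    for S h and c Y :: "'z::topological_space \<Rightarrow> 'a"
    by (rule continuous_on_linear_family[OF lin2 _ that(2)])
       (rule continuous_on_compose2[OF cont that(1)], simp)
  define f where "f p = integral {0..1::real} (\<lambda>t. \<alpha> (t *\<^sub>R p) p)" for p
  have ci: "continuous_on {0..1} (\<lambda>t. \<alpha> (t *\<^sub>R p) p)" for p
    by (intro c1 continuous_intros)
  have cG: "continuous_on (UNIV \<times> cbox 0 1) (\<lambda>(p, t). G p t)"
    by (rule continuous_on_blinfun_componentwise)
       (auto simp: G case_prod_beta intro!: c1 c2 continuous_intros)
  have D: "(f has_derivative integral (cbox 0 1) (G p)) (at p within UNIV)" for p
    unfolding f_def cbox_interval[symmetric]
    by (rule leibniz_rule[OF _ _ cG])
       (use int ci in \<open>auto simp: G cbox_interval intro!: integrable_continuous_interval\<close>)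
  have "blinfun_apply (integral (cbox 0 1) (G p)) h = \<alpha> p h" for p h
  proof -
    have "continuous_on (cbox 0 1) (\<lambda>t. case (p, t) of (p, t) \<Rightarrow> G p t)"
      by (rule continuous_on_compose2[OF cG]) (auto intro!: continuous_intros)
    then have "continuous_on (cbox 0 1) (G p)" by simp
    then have i: "G p integrable_on cbox 0 1" by (rule integrable_continuous)
    have "blinfun_apply (integral (cbox 0 1) (G p)) h = integral (cbox 0 1) (\<lambda>t. G p t h)"
      using i by (rule blinfun_apply_integral)
    also have "\<dots> = integral {0..1} (\<lambda>t. t * \<alpha>' (t *\<^sub>R p) p h + \<alpha> (t *\<^sub>R p) h)"
      by (simp add: G closed[of _ h] cbox_interval)
    also have "\<dots> = 1 * \<alpha> (1 *\<^sub>R p) h - 0 * \<alpha> (0 *\<^sub>R p) h"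
    proof (intro integral_unique fundamental_theorem_of_calculus)
      fix t :: real
      have "((\<lambda>t. \<alpha> (t *\<^sub>R p) h) has_real_derivative \<alpha>' (t *\<^sub>R p) p h) (at t)"
        using has_real_derivative_along_line[of "\<lambda>q. \<alpha> q h" "\<lambda>k. \<alpha>' (t *\<^sub>R p) k h" 0 t p]
          der[of h "t *\<^sub>R p"] by simp
      from DERIV_mult[OF DERIV_ident this]
      have "((\<lambda>t. t * \<alpha> (t *\<^sub>R p) h) has_real_derivative
          t * \<alpha>' (t *\<^sub>R p) p h + \<alpha> (t *\<^sub>R p) h) (at t within {0..1})"
        by (rule has_field_derivative_at_within[OF DERIV_cong]) simp
      then show "((\<lambda>t. t * \<alpha> (t *\<^sub>R p) h) has_vector_derivative
          t * \<alpha>' (t *\<^sub>R p) p h + \<alpha> (t *\<^sub>R p) h) (at t within {0..1})"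
        by (simp add: has_real_derivative_iff_has_vector_derivative)
    qed simp
    finally show ?thesis by simp
  qed
  then have "blinfun_apply (integral (cbox 0 1) (G p)) = \<alpha> p" for p by auto
  with D that show ?thesis by auto
qed

section \<open>Linear algebra\<close>

text \<open>
  The map sending \<open>x\<close> to the functional \<open>B x\<close> is injective, hence bijective by dimension.  This
  gives sense to every definite description below: the Levi-Civita connection, Hamiltonian fields
  and gradients.
\<close>

lemma nondegenerate_form_represents:
  fixes B :: "'a::euclidean_space \<Rightarrow> 'a \<Rightarrow> real"
  assumes bil: "bilinear B" and nondeg: "\<And>u. (\<And>w. B u w = 0) \<Longrightarrow> u = 0" and lin: "linear \<phi>"
  shows "\<exists>!x. \<forall>w. B x w = \<phi> w"
proof -
  have b2: "linear (B u)" and b1: "linear (\<lambda>u. B u w)" for u w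
    using bil by (auto simp: bilinear_def)
  define T where "T x = (\<Sum>b\<in>Basis. B x b *\<^sub>R b)" for x
  have T: "T x \<bullet> w = B x w" for x w
    using linear_expansion[OF b2, of x w]
    by (simp add: T_def inner_sum_left inner_commute[of w] mult.commute)
  have "linear T"
    by (rule linearI)
       (simp_all add: T_def linear_add[OF b1] linear_scale[OF b1] scaleR_add_left sum.distrib scaleR_sum_right)
  have inj: "x = y" if "\<And>w. B x w = B y w" for x y
    using nondeg[of "x - y"] that by (simp add: linear_diff[OF b1])
  have "inj T" by (rule injI, rule inj) (simp flip: T)
  then have "surj T" using \<open>linear T\<close> linear_injective_imp_surjective by blast
  then obtain x where x: "T x = (\<Sum>b\<in>Basis. \<phi> b *\<^sub>R b)" by (metis surjD)
  have "B x w = \<phi> w" for w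
    unfolding T[symmetric] x using linear_expansion[OF lin, of w]
    by (simp add: inner_sum_left inner_commute[of w] mult.commute)
  with inj show ?thesis by (metis (no_types))
qed

lemma independent_family:
  fixes f :: "'i \<Rightarrow> 'a::real_vector"
  assumes "finite A" and zero: "\<And>c. (\<Sum>i\<in>A. c i *\<^sub>R f i) = 0 \<Longrightarrow> \<forall>i\<in>A. c i = 0"
  shows "inj_on f A \<and> independent (f ` A)"
proof
  show inj: "inj_on f A"
  proof (rule inj_onI, rule ccontr)
    fix i j assume ij: "i \<in> A" "j \<in> A" "f i = f j" "i \<noteq> j"
    have "(\<Sum>k\<in>A. ((if k = i then 1 else 0) - (if k = j then 1 else 0)) *\<^sub>R f k)
        = (\<Sum>k\<in>A. if k = i then f k else 0) - (\<Sum>k\<in>A. if k = j then f k else 0)"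
      by (subst sum_subtractf[symmetric], rule sum.cong) (auto simp: scaleR_diff_left)
    also have "\<dots> = 0" using ij \<open>finite A\<close> by simp
    finally show False using zero ij by fastforce
  qed
  show "independent (f ` A)"
  proof (rule independent_if_scalars_zero)
    fix u x assume "(\<Sum>y\<in>f ` A. u y *\<^sub>R y) = 0" "x \<in> f ` A"
    then show "u x = 0" using zero[of "u \<circ> f"] by (auto simp: sum.reindex[OF inj])
  qed (use \<open>finite A\<close> in simp)
qed

section \<open>Riemannian metrics in a chart\<close>

locale riemannian_metric =
  fixes g :: "'a::euclidean_space \<Rightarrow> 'a \<Rightarrow> 'a \<Rightarrow> real"
  assumes metric_bilinear: "bilinear (g p)"
    and metric_sym: "g p u v = g p v u"
    and metric_pos: "u \<noteq> 0 \<Longrightarrow> 0 < g p u u"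
    and metric_differentiable: "(\<lambda>q. g q u v) differentiable (at p)"
begin

definition dg :: "'a \<Rightarrow> 'a \<Rightarrow> 'a \<Rightarrow> 'a \<Rightarrow> real" where
  "dg p h u v = differential (\<lambda>q. g q u v) p h"

lemma dg: "((\<lambda>q. g q u v) has_derivative (\<lambda>h. dg p h u v)) (at p)"
  unfolding dg_def by (rule has_derivative_differential[OF metric_differentiable, unfolded eta_contract_eq])

lemma linear_g: "linear (\<lambda>u. g p u v)" "linear (g p u)"
  using metric_bilinear by (auto simp: bilinear_def)

lemma linear_dg: "linear (\<lambda>h. dg p h u v)" "linear (\<lambda>u. dg p h u v)" "linear (dg p h u)"
  using has_derivative_linear[OF dg]
    linear_family_derivative_linear[where T="\<lambda>q u. g q u v" and T'="\<lambda>h u. dg p h u v", OF linear_g(1) dg]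
    linear_family_derivative_linear[where T="\<lambda>q. g q u" and T'="\<lambda>h. dg p h u", OF linear_g(2) dg]
  by auto

lemmas g_simps =
  linear_add[OF linear_g(1)] linear_add[OF linear_g(2)] linear_diff[OF linear_g(1)]
  linear_diff[OF linear_g(2)] linear_neg[OF linear_g(1)] linear_neg[OF linear_g(2)]
  linear_scale[OF linear_g(1)] linear_scale[OF linear_g(2)] linear_0[OF linear_g(1)]
  linear_0[OF linear_g(2)]

lemmas dg_simps =
  linear_add[OF linear_dg(1)] linear_add[OF linear_dg(2)] linear_add[OF linear_dg(3)]
  linear_scale[OF linear_dg(1)] linear_scale[OF linear_dg(2)] linear_scale[OF linear_dg(3)]
  linear_0[OF linear_dg(1)] linear_0[OF linear_dg(2)] linear_0[OF linear_dg(3)]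

lemma dg_sym: "dg p h u v = dg p h v u"
  unfolding dg_def by (subst metric_sym) rule

lemma g_eqI:
  assumes "\<And>w. g p x w = g p y w"
  shows "x = y"
  using assms[of "x - y"] metric_pos[of "x - y" p] by (auto simp: g_simps)

lemma g_nonneg: "0 \<le> g p u u"
  using metric_pos[of u p] by (cases "u = 0") (auto simp: g_simps)

text \<open>
  Koszul's formula both defines a torsion-free metric connection and is forced by these two
  properties.
\<close>

lemma levi_civita_koszul:
  "bilinear (levi_civita g p)"
  "2 * g p (levi_civita g p u v) w = dg p u v w + dg p v u w - dg p w u v"
proof -
  define P where "P \<Gamma> \<longleftrightarrow> (\<forall>p. bilinear (\<Gamma> p)) \<and> (\<forall>p u v. \<Gamma> p u v = \<Gamma> p v u) \<and>
     (\<forall>p u v w. dg p u v w = g p (\<Gamma> p u v) w + g p v (\<Gamma> p u w))" for \<Gamma>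
  define \<Gamma> where "\<Gamma> p u v =
    (THE x. \<forall>w. g p x w = (dg p u v w + dg p v u w - dg p w u v) / 2)" for p u v
  have "\<exists>!x. \<forall>w. g p x w = (dg p u v w + dg p v u w - dg p w u v) / 2" for p u v
  proof (rule nondegenerate_form_represents[OF metric_bilinear])
    show "u = 0" if "\<And>w. g p u w = 0" for u
      using that by (intro g_eqI[of p]) (simp add: g_simps)
    show "linear (\<lambda>w. (dg p u v w + dg p v u w - dg p w u v) / 2)"
      by (rule linearI) (simp_all add: dg_simps field_simps)
  qed
  from theI'[OF this] have K: "g p (\<Gamma> p u v) w = (dg p u v w + dg p v u w - dg p w u v) / 2" for p u v w
    unfolding \<Gamma>_def by blast
  have "bilinear (\<Gamma> p)" for p
    unfolding bilinear_def
    by (intro conjI allI linearI; rule g_eqI[of p]; simp add: g_simps K dg_simps field_simps)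
  moreover have "\<Gamma> p u v = \<Gamma> p v u" for p u v
    by (rule g_eqI[of p]) (simp add: K dg_sym[of _ _ u v])
  moreover have "dg p u v w = g p (\<Gamma> p u v) w + g p v (\<Gamma> p u w)" for p u v w
    unfolding metric_sym[of p v] K using dg_sym[of p u v w] dg_sym[of p v w u] dg_sym[of p w v u]
    by (simp add: field_simps)
  ultimately have P\<Gamma>: "P \<Gamma>" unfolding P_def by blast
  have uniq: "\<Delta> = \<Gamma>" if "P \<Delta>" for \<Delta>
  proof (intro ext)
    fix p u v
    have s: "\<Delta> p u v = \<Delta> p v u" and c: "dg p u v w = g p (\<Delta> p u v) w + g p v (\<Delta> p u w)" for u v w
      using that unfolding P_def by blast+
    have "2 * g p (\<Delta> p u v) w = dg p u v w + dg p v u w - dg p w u v" for w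
      using c[of u v w] c[of v u w] c[of w u v] s[of v u] s[of w u] s[of w v]
        metric_sym[of p v "\<Delta> p u w"] by simp
    then show "\<Delta> p u v = \<Gamma> p u v"
      by (intro g_eqI[of p]) (simp add: K eq_divide_eq mult.commute)
  qed
  have "levi_civita g = (THE \<Gamma>. P \<Gamma>)"
    unfolding levi_civita_def P_def dg_def ..
  also have "\<dots> = \<Gamma>" using P\<Gamma> uniq by blast
  finally have lc: "levi_civita g = \<Gamma>" .
  show "bilinear (levi_civita g p)"
    unfolding lc using P\<Gamma> by (simp add: P_def)
  show "2 * g p (levi_civita g p u v) w = dg p u v w + dg p v u w - dg p w u v"
    unfolding lc using K[of p u v w] by simp
qed

text \<open>
  The Sasaki metric is positive definite: the two squares in it first kill the horizontal part of a
  null vector and then its vertical part.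
\<close>

lemma gradient_sasaki:
  assumes "linear (differential \<phi> v)"
  shows "sasaki_metric g v (gradient (sasaki_metric g) \<phi> v) U = differential \<phi> v U"
proof -
  obtain p s where v: "v = (p, s)" by fastforce
  have \<Gamma>: "linear (\<lambda>u. levi_civita g p u s)"
    using levi_civita_koszul(1) by (auto simp: bilinear_def)
  note \<Gamma>s = linear_add[OF \<Gamma>] linear_scale[OF \<Gamma>] linear_0[OF \<Gamma>]
  have "\<exists>!X. \<forall>U. sasaki_metric g v X U = differential \<phi> v U"
  proof (rule nondegenerate_form_represents)
    show "bilinear (sasaki_metric g v)"
      unfolding bilinear_def v sasaki_metric_def
      by (intro conjI allI linearI; simp add: g_simps \<Gamma>s algebra_simps)
    fix U assume "\<And>W. sasaki_metric g v U W = 0"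
    from this[of U] have "g p (fst U) (fst U) + g p (snd U + levi_civita g p (fst U) s)
        (snd U + levi_civita g p (fst U) s) = 0"
      by (simp add: v sasaki_metric_def)
    then have "g p (fst U) (fst U) = 0" and
      *: "g p (snd U + levi_civita g p (fst U) s) (snd U + levi_civita g p (fst U) s) = 0"
      using g_nonneg[of p "fst U"] g_nonneg[of p "snd U + levi_civita g p (fst U) s"] by linarith+
    then have 1: "fst U = 0" using metric_pos[of "fst U" p] by fastforce
    with * have "g p (snd U) (snd U) = 0" by (simp add: \<Gamma>s)
    then have "snd U = 0" using metric_pos[of "snd U" p] by fastforce
    with 1 show "U = 0" by (simp add: prod_eq_iff)
  qed (rule assms)
  from theI'[OF this] show ?thesis unfolding gradient_def by blast
qed

end

section \<open>Noether integrals of a magnetic system\<close>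

locale magnetic_system = riemannian_metric g
  for g :: "'a::euclidean_space \<Rightarrow> 'a \<Rightarrow> 'a \<Rightarrow> real" +
  fixes F :: "'a \<Rightarrow> 'a \<Rightarrow> 'a"
  assumes lorentz: "lorentz_force g F"
begin

definition \<omega> :: "'a \<Rightarrow> 'a \<Rightarrow> 'a \<Rightarrow> real" where
  "\<omega> p u v = g p (F p u) v"

lemma F_skew: "g p (F p u) v = - g p u (F p v)"
  using lorentz by (simp add: lorentz_force_def)

lemma \<omega>_skew: "\<omega> p u v = - \<omega> p v u"
  unfolding \<omega>_def using F_skew[of p u v] metric_sym[of p u] by simp

text \<open>
  The second conjunct is the Killing equation, the Lie derivative of \<open>g\<close> along \<open>R\<close> written in the
  chart.  The third says that \<open>f\<close> is a primitive of the contraction of \<open>\<omega>\<close> with \<open>R\<close>, which makes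
  \<open>R\<close> preserve the closed form \<open>\<omega>\<close>.
\<close>

definition infinitesimal_symmetry :: "('a \<Rightarrow> 'a) \<Rightarrow> ('a \<Rightarrow> real) \<Rightarrow> bool" where
  "infinitesimal_symmetry R f \<longleftrightarrow>
     (\<forall>p. R differentiable (at p)) \<and>
     (\<forall>p u v. dg p (R p) u v + g p (differential R p u) v + g p u (differential R p v) = 0) \<and>
     (\<forall>p. (f has_derivative \<omega> p (R p)) (at p))"

definition noether_integral :: "('a \<Rightarrow> 'a) \<Rightarrow> ('a \<Rightarrow> real) \<Rightarrow> 'a \<times> 'a \<Rightarrow> real" where
  "noether_integral R f v = g (fst v) (snd v) (R (fst v)) + f (fst v)"

lemma has_derivative_noether_integral:
  assumes "infinitesimal_symmetry R f"
  shows "(noether_integral R f has_derivative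
    (\<lambda>U. dg p (fst U) s (R p) + g p (snd U) (R p) + g p s (differential R p (fst U))
       + \<omega> p (R p) (fst U))) (at (p, s))"
proof -
  have R: "(R has_derivative differential R p) (at p)" and f: "(f has_derivative \<omega> p (R p)) (at p)"
    using assms has_derivative_differential unfolding infinitesimal_symmetry_def by blast+
  have fst: "(fst has_derivative fst) (at z)" and snd: "(snd has_derivative snd) (at z)" for z :: "'a \<times> 'a"
    by (auto intro!: derivative_eq_intros)
  have RR: "((\<lambda>z. R (fst z)) has_derivative (\<lambda>U. differential R p (fst U))) (at (p, s))"
    by (rule has_derivative_compose[OF fst]) (simp add: R)
  have ff: "((\<lambda>z. f (fst z)) has_derivative (\<lambda>U. \<omega> p (R p) (fst U))) (at (p, s))"
    by (rule has_derivative_compose[OF fst]) (simp add: f)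
  have "((\<lambda>z. g (fst z) (snd z) (R (fst z))) has_derivative (\<lambda>U. dg (fst (p, s)) (fst U) (snd (p, s)) (R (fst (p, s)))
     + g (fst (p, s)) (snd U) (R (fst (p, s))) + g (fst (p, s)) (snd (p, s)) (differential R p (fst U)))) (at (p, s))"
    by (rule has_derivative_bilinear_family[OF metric_bilinear dg fst snd RR])
  from has_derivative_add[OF this ff] show ?thesis
    unfolding noether_integral_def by simp
qed

lemma has_derivative_energy:
  "(energy g has_derivative (\<lambda>U. 1 / 2 * dg p (fst U) s s + g p (snd U) s)) (at (p, s))"
proof -
  have fst: "(fst has_derivative fst) (at z)" and snd: "(snd has_derivative snd) (at z)" for z :: "'a \<times> 'a"
    by (auto intro!: derivative_eq_intros)
  have "((\<lambda>z. g (fst z) (snd z) (snd z)) has_derivative (\<lambda>U. dg (fst (p, s)) (fst U) (snd (p, s)) (snd (p, s))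
     + g (fst (p, s)) (snd U) (snd (p, s)) + g (fst (p, s)) (snd (p, s)) (snd U))) (at (p, s))"
    by (rule has_derivative_bilinear_family[OF metric_bilinear dg fst snd snd])
  from has_derivative_mult_right[OF this, of "1/2"] show ?thesis
    unfolding energy_def by (simp add: metric_sym[of p s] algebra_simps)
qed

text \<open>
  Along a magnetic geodesic with velocity \<open>v\<close> the derivative of the integral is
  \<open>g(F v, R) + g(v, \<nabla>\<^sub>v R) + \<omega>(R, v)\<close>.  The middle term vanishes by the Killing equation, and the
  two others cancel by skew-symmetry of \<open>F\<close>.
\<close>

lemma first_integral_noether:
  assumes "infinitesimal_symmetry R f"
  shows "first_integral g F (noether_integral R f)"
  unfolding first_integral_def
proof (intro conjI allI impI)
  let ?\<Psi> = "noether_integral R f"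
  show "?\<Psi> differentiable (at v)" for v
    using has_derivative_noether_integral[OF assms, of "fst v" "snd v"] by (auto simp: differentiable_def)
  fix I \<gamma> assume mg: "magnetic_geodesic g F I \<gamma>"
  have "((\<lambda>t. ?\<Psi> (\<gamma> t, velocity \<gamma> t)) has_derivative (\<lambda>h. 0)) (at t)" if t: "t \<in> I" for t
  proof -
    define p v a where "p = \<gamma> t" and "v = velocity \<gamma> t" and "a = vector_derivative (velocity \<gamma>) (at t)"
    have "(\<gamma> has_derivative (\<lambda>h. h *\<^sub>R v)) (at t)" "(velocity \<gamma> has_derivative (\<lambda>h. h *\<^sub>R a)) (at t)"
      and eq: "a + levi_civita g p v v = F p v"
      using mg t by (auto simp: magnetic_geodesic_def p_def v_def a_def velocity_def
          vector_derivative_works has_vector_derivative_def)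
    then have c: "((\<lambda>t. (\<gamma> t, velocity \<gamma> t)) has_derivative (\<lambda>h. h *\<^sub>R (v, a))) (at t)"
      by (auto intro!: derivative_eq_intros)
    have "((\<lambda>t. ?\<Psi> (\<gamma> t, velocity \<gamma> t)) has_derivative (\<lambda>h. (\<lambda>U. dg p (fst U) v (R p)
       + g p (snd U) (R p) + g p v (differential R p (fst U))
       + \<omega> p (R p) (fst U)) (h *\<^sub>R (v, a)))) (at t)"
      by (rule has_derivative_compose[OF c])
         (use has_derivative_noether_integral[OF assms, of p v] in \<open>simp add: p_def v_def\<close>)
    moreover have "dg p (h *\<^sub>R v) v (R p) + g p (h *\<^sub>R a) (R p) + g p v (differential R p (h *\<^sub>R v))
       + \<omega> p (R p) (h *\<^sub>R v) = 0" for h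
    proof -
      have "linear (differential R p)"
        using assms by (auto simp: infinitesimal_symmetry_def intro: linear_frechet_derivative)
      then have "dg p (h *\<^sub>R v) v (R p) + g p (h *\<^sub>R a) (R p) + g p v (differential R p (h *\<^sub>R v))
          + \<omega> p (R p) (h *\<^sub>R v)
        = h * (dg p v v (R p) + g p a (R p) + g p v (differential R p v) + \<omega> p (R p) v)"
        by (simp add: dg_simps g_simps \<omega>_def linear_scale algebra_simps)
      also have "g p a (R p) = g p (F p v) (R p) - g p (levi_civita g p v v) (R p)"
        unfolding eq[symmetric] by (simp add: g_simps)
      also have "g p (F p v) (R p) = - \<omega> p (R p) v"
        by (subst \<omega>_skew) (simp add: \<omega>_def)
      also have "g p (levi_civita g p v v) (R p) = dg p v v (R p) - 1 / 2 * dg p (R p) v v"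
        using levi_civita_koszul(2)[of p v v "R p"] by simp
      also have "g p v (differential R p v) = - 1 / 2 * dg p (R p) v v"
      proof -
        have "dg p (R p) v v + g p (differential R p v) v + g p v (differential R p v) = 0"
          using assms by (simp add: infinitesimal_symmetry_def)
        then show ?thesis using metric_sym[of p v "differential R p v"] by simp
      qed
      finally show ?thesis by simp
    qed
    ultimately show ?thesis by simp
  qed
  moreover have "convex I"
    using mg by (simp add: magnetic_geodesic_def is_interval_convex)
  ultimately have "\<exists>c. \<forall>t\<in>I. ?\<Psi> (\<gamma> t, velocity \<gamma> t) = c"
    by (intro has_derivative_zero_constant) (auto intro: has_derivative_at_withinI)
  then show "(\<lambda>t. ?\<Psi> (\<gamma> t, velocity \<gamma> t)) constant_on I"
    by (auto simp: constant_on_def)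
qed

lemma magnetic_form_eq:
  "magnetic_form g F (p, s) U W =
     - (dg p (fst U) s (fst W) + g p (snd U) (fst W)) + (dg p (fst W) s (fst U) + g p (snd W) (fst U))
     + \<omega> p (fst U) (fst W)"
proof -
  have fst: "(fst has_derivative fst) (at z)" and snd: "(snd has_derivative snd) (at z)" for z :: "'a \<times> 'a"
    by (auto intro!: derivative_eq_intros)
  have "((\<lambda>z. tautological_form g z W) has_derivative (\<lambda>U. dg (fst (p, s)) (fst U) (snd (p, s)) (fst W)
     + g (fst (p, s)) (snd U) (fst W) + g (fst (p, s)) (snd (p, s)) ((\<lambda>_. 0) U))) (at (p, s))" for W
    unfolding tautological_form_def
    by (rule has_derivative_bilinear_family[OF metric_bilinear dg fst snd has_derivative_const])
  from differential_eqI[OF this] show ?thesis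
    by (simp add: magnetic_form_def exterior_derivative1_def \<omega>_def g_simps)
qed

text \<open>
  Vertical test vectors detect the horizontal part of \<open>X - Y\<close>; once this is zero, horizontal ones
  detect the vertical part.
\<close>

lemma magnetic_form_eqI:
  assumes "\<And>U. magnetic_form g F (p, s) X U = magnetic_form g F (p, s) Y U"
  shows "X = Y"
proof -
  have 1: "fst X = fst Y"
    using assms[of "(0, _)"] by (intro g_eqI[of p]) (simp add: magnetic_form_eq \<omega>_def g_simps dg_simps metric_sym)
  moreover have "snd X = snd Y"
    using assms[of "(_, 0)"] by (intro g_eqI[of p]) (simp add: magnetic_form_eq 1 g_simps dg_simps)
  ultimately show ?thesis by (simp add: prod_eq_iff)
qed

text \<open>
  The Hamiltonian field is the complete lift of \<open>R\<close>, the generator of the flow that \<open>R\<close> induces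
  on the tangent bundle.
\<close>

lemma hamiltonian_field_noether:
  assumes "infinitesimal_symmetry R f"
  shows "hamiltonian_field g F (noether_integral R f) (p, s) = (R p, differential R p s)"
  unfolding hamiltonian_field_def
proof (rule the_equality)
  have K: "dg p (R p) s u + g p (differential R p s) u + g p s (differential R p u) = 0" for u
    using assms by (auto simp: infinitesimal_symmetry_def)
  show *: "\<forall>U. magnetic_form g F (p, s) (R p, differential R p s) U
      = differential (noether_integral R f) (p, s) U"
  proof
    fix U show "magnetic_form g F (p, s) (R p, differential R p s) U
      = differential (noether_integral R f) (p, s) U"
      unfolding differential_eqI[OF has_derivative_noether_integral[OF assms]] magnetic_form_eq
      using K[of "fst U"] by simp
  qed
  show "X = (R p, differential R p s)"
    if "\<forall>U. magnetic_form g F (p, s) X U = differential (noether_integral R f) (p, s) U" for X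
    by (rule magnetic_form_eqI[of p s]) (simp only: that[rule_format] *[rule_format])
qed

text \<open>
  The difference of the two derivatives is the bracket \<open>[S, R]\<close> of vector fields.
\<close>

lemma magnetic_poisson_noether:
  assumes 1: "infinitesimal_symmetry R f" and 2: "infinitesimal_symmetry S h"
  shows "magnetic_poisson g F (noether_integral R f) (noether_integral S h) (p, s)
    = g p s (differential R p (S p) - differential S p (R p)) + \<omega> p (R p) (S p)"
proof -
  have K: "dg p (S p) s (R p) + g p (differential S p s) (R p) + g p s (differential S p (R p)) = 0"
    "dg p (R p) s (S p) + g p (differential R p s) (S p) + g p s (differential R p (S p)) = 0"
    using 1 2 unfolding infinitesimal_symmetry_def by blast+
  show ?thesis
    unfolding magnetic_poisson_def hamiltonian_field_noether[OF 1] hamiltonian_field_noether[OF 2]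
      magnetic_form_eq using K by (simp add: g_simps)
qed

text \<open>
  Involution is immediate from the formula for the bracket.  On vertical vectors \<open>(0, w)\<close> the
  differentials of the energy and of the integrals at \<open>(p, s)\<close> are \<open>g(s, w)\<close> and \<open>g(R\<^sub>i(p), w)\<close>.
  Hence the gradients are independent whenever \<open>s\<close> lies outside the span of the \<open>R\<^sub>i(p)\<close>, and the
  complement of a proper subspace of each fibre is dense.
\<close>

theorem commuting_symmetries_integrable:
  fixes R :: "nat \<Rightarrow> 'a \<Rightarrow> 'a" and f :: "nat \<Rightarrow> 'a \<Rightarrow> real"
  defines "J \<equiv> {1..DIM('a) - 1}"
  assumes symm: "\<And>i. i \<in> J \<Longrightarrow> infinitesimal_symmetry (R i) (f i)"
    and comm: "\<And>i j p. i \<in> J \<Longrightarrow> j \<in> J \<Longrightarrow> differential (R i) p (R j p) = differential (R j) p (R i p)"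
    and isotropic: "\<And>i j p. i \<in> J \<Longrightarrow> j \<in> J \<Longrightarrow> \<omega> p (R i p) (R j p) = 0"
    and indep: "\<And>p c. (\<Sum>i\<in>J. c i *\<^sub>R R i p) = 0 \<Longrightarrow> \<forall>i\<in>J. c i = 0"
  shows "completely_integrable g F"
proof -
  define \<Psi> where "\<Psi> i = noether_integral (R i) (f i)" for i
  define \<Phi> where "\<Phi> i = (if i = 0 then energy g else \<Psi> i)" for i
  define S where "S p = span ((\<lambda>i. R i p) ` J)" for p
  define D where "D = {(p, s). s \<notin> S p}"
  have fi: "first_integral g F (\<Psi> i)" if "i \<in> J" for i
    unfolding \<Psi>_def by (rule first_integral_noether[OF symm[OF that]])
  have pb: "magnetic_poisson g F (\<Psi> i) (\<Psi> j) v = 0" if "i \<in> J" "j \<in> J" for i j v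
    using magnetic_poisson_noether[OF symm symm, of i j "fst v" "snd v"] comm isotropic that
    unfolding \<Psi>_def by (simp add: g_simps)
  have "closure D = UNIV"
  proof -
    have "z \<in> closure D" for z
    proof -
      obtain p s where z: "z = (p, s)" by fastforce
      have "dim (S p) \<le> card ((\<lambda>i. R i p) ` J)" unfolding S_def dim_span by (rule dim_le_card') (simp add: J_def)
      also have "\<dots> \<le> card J" by (rule card_image_le) (simp add: J_def)
      also have "\<dots> < DIM('a)" by (simp add: J_def)
      finally have "S p \<noteq> UNIV" by auto
      then obtain w where w: "w \<notin> S p" by auto
      show ?thesis
      proof (cases "s \<in> S p")
        case False
        then show ?thesis using closure_subset[of D] by (auto simp: D_def z)
      next
        case True
        have out: "s + t *\<^sub>R w \<notin> S p" if "t \<noteq> 0" for t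
        proof
          assume "s + t *\<^sub>R w \<in> S p"
          then have "(1 / t) *\<^sub>R ((s + t *\<^sub>R w) - s) \<in> S p"
            unfolding S_def using True[unfolded S_def] by (intro span_scale span_diff)
          then show False using w that by simp
        qed
        show ?thesis
          unfolding closure_approachable
        proof (intro allI impI)
          fix e :: real assume e: "0 < e"
          \<comment> \<open>any \<open>t > 0\<close> with \<open>t * norm w < e\<close> will do\<close>
          define t where "t = e / (2 * (norm w + 1))"
          have np: "norm w + 1 > 0" by (simp add: add_nonneg_pos)
          have t: "t > 0" using e np by (simp add: t_def)
          have "t * norm w < t * (2 * (norm w + 1))" using t np by (intro mult_strict_left_mono) auto
          also have "\<dots> = e" using np by (simp add: t_def)
          finally have "dist (p, s + t *\<^sub>R w) z < e" using t by (simp add: z dist_prod_def dist_norm)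
          moreover have "(p, s + t *\<^sub>R w) \<in> D" using out t by (simp add: D_def)
          ultimately show "\<exists>y\<in>D. dist y z < e" by blast
        qed
      qed
    qed
    then show ?thesis by blast
  qed
  moreover have "inj_on (\<lambda>i. gradient (sasaki_metric g) (\<Phi> i) v) {0..DIM('a) - 1} \<and>
      independent ((\<lambda>i. gradient (sasaki_metric g) (\<Phi> i) v) ` {0..DIM('a) - 1})" if v: "v \<in> D" for v
  proof (rule independent_family)
    obtain p s where ps: "v = (p, s)" by fastforce
    have s: "s \<notin> S p" using v by (simp add: D_def ps)
    have split: "{0..DIM('a) - 1} = insert 0 J" "0 \<notin> J" "finite J" by (auto simp: J_def)
    fix c assume 0: "(\<Sum>i = 0..DIM('a) - 1. c i *\<^sub>R gradient (sasaki_metric g) (\<Phi> i) v) = 0"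
    have dE: "(\<Phi> 0 has_derivative (\<lambda>U. 1 / 2 * dg p (fst U) s s + g p (snd U) s)) (at v)"
      using has_derivative_energy by (simp add: ps \<Phi>_def)
    have d\<Psi>: "(\<Phi> i has_derivative (\<lambda>U. dg p (fst U) s (R i p) + g p (snd U) (R i p)
        + g p s (differential (R i) p (fst U)) + \<omega> p (R i p) (fst U))) (at v)" if "i \<in> J" for i
      using has_derivative_noether_integral[OF symm[OF that]] that split by (auto simp: ps \<Phi>_def \<Psi>_def)
    have lin: "linear (differential (\<Phi> i) v)" if "i \<in> insert 0 J" for i
      using that dE d\<Psi> by (intro linear_frechet_derivative) (auto simp: differentiable_def)
    have lin2: "linear (\<lambda>X. sasaki_metric g v X (0, w))" for w
    proof -
      have \<Gamma>: "linear (\<lambda>u. levi_civita g p u s)"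
        using levi_civita_koszul(1) by (auto simp: bilinear_def)
      show ?thesis
        by (rule linearI)
           (simp_all add: sasaki_metric_def ps linear_add[OF \<Gamma>] linear_scale[OF \<Gamma>] g_simps algebra_simps)
    qed
    have "c 0 *\<^sub>R s + (\<Sum>i\<in>J. c i *\<^sub>R R i p) = 0"
    proof (rule g_eqI[of p])
      fix w
      have R0: "differential (R i) p 0 = 0" if "i \<in> J" for i
        using symm[OF that] by (auto simp: infinitesimal_symmetry_def intro!: linear_0 linear_frechet_derivative)
      have "0 = sasaki_metric g v (\<Sum>i\<in>insert 0 J. c i *\<^sub>R gradient (sasaki_metric g) (\<Phi> i) v) (0, w)"
        using 0 by (simp only: split(1) linear_0[OF lin2])
      also have "\<dots> = (\<Sum>i\<in>insert 0 J. c i * differential (\<Phi> i) v (0, w))"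
        by (simp add: linear_sum[OF lin2] linear_scale[OF lin2] gradient_sasaki[OF lin] del: sum.insert)
      also have "\<dots> = c 0 * g p w s + (\<Sum>i\<in>J. c i * g p w (R i p))"
        using split by (simp add: differential_eqI[OF dE] differential_eqI[OF d\<Psi>] dg_simps R0
            g_simps \<omega>_def cong: sum.cong)
      also have "\<dots> = g p (c 0 *\<^sub>R s + (\<Sum>i\<in>J. c i *\<^sub>R R i p)) w"
        by (simp add: g_simps linear_sum[OF linear_g(1)] metric_sym[of p w])
      finally show "g p (c 0 *\<^sub>R s + (\<Sum>i\<in>J. c i *\<^sub>R R i p)) w = g p 0 w" by (simp add: g_simps)
    qed
    moreover have "c 0 = 0"
    proof (rule ccontr)
      assume "c 0 \<noteq> 0"
      moreover have "(\<Sum>i\<in>J. c i *\<^sub>R R i p) = - (c 0 *\<^sub>R s)"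
        using \<open>c 0 *\<^sub>R s + _ = 0\<close> by (simp add: eq_neg_iff_add_eq_0 add.commute)
      ultimately have "(- 1 / c 0) *\<^sub>R (\<Sum>i\<in>J. c i *\<^sub>R R i p) = s" by simp
      moreover have "(- 1 / c 0) *\<^sub>R (\<Sum>i\<in>J. c i *\<^sub>R R i p) \<in> S p"
        unfolding S_def by (intro span_scale span_sum span_base) auto
      ultimately show False using s by simp
    qed
    ultimately show "\<forall>i\<in>{0..DIM('a) - 1}. c i = 0"
      unfolding split(1) using indep[of c p] by simp
  qed simp
  ultimately show ?thesis
    unfolding completely_integrable_def Let_def using fi pb
    by (intro exI[of _ \<Psi>] conjI exI[of _ D]) (auto simp: J_def \<Phi>_def)
qed

end

section \<open>Lie groups in a global chart\<close>

locale lie_group_chart =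
  fixes mul :: "'a::euclidean_space \<Rightarrow> 'a \<Rightarrow> 'a" and e :: 'a and ginv :: "'a \<Rightarrow> 'a"
  assumes lie_group: "lie_group mul e ginv"
begin

sublocale grp: group mul e ginv
  using lie_group by (simp add: lie_group_def)

text \<open>
  All tensors and fields on the group are expressed by the first two derivatives of the
  multiplication, as a map on pairs; the symmetry of \<open>D2\<close> exchanges a derivative in the left factor
  with one in the right factor.
\<close>

definition D :: "'a \<times> 'a \<Rightarrow> 'a \<times> 'a \<Rightarrow> 'a" where
  "D z = differential (\<lambda>(x, y). mul x y) z"

definition D2 :: "'a \<times> 'a \<Rightarrow> 'a \<times> 'a \<Rightarrow> 'a \<times> 'a \<Rightarrow> 'a" where
  "D2 z h = differential (\<lambda>z. D z h) z"

lemma has_derivative_D: "((\<lambda>(x, y). mul x y) has_derivative D z) (at z)"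
  and has_derivative_D2: "((\<lambda>z. D z h) has_derivative D2 z h) (at z)"
  and continuous_D2: "continuous_on UNIV (\<lambda>z. D2 z h k)"
proof -
  have "C_diff (Suc (Suc 0)) (\<lambda>(x, y). mul x y)"
    using lie_group by (simp only: lie_group_def smooth_def)
  then have "\<forall>z. (\<lambda>(x, y). mul x y) differentiable (at z)"
    "\<forall>h z. (\<lambda>z. D z h) differentiable (at z)" "\<forall>h k. continuous_on UNIV (\<lambda>z. D2 z h k)"
    unfolding C_diff.simps D_def D2_def by blast+
  then show "((\<lambda>(x, y). mul x y) has_derivative D z) (at z)"
    "((\<lambda>z. D z h) has_derivative D2 z h) (at z)" "continuous_on UNIV (\<lambda>z. D2 z h k)"
    unfolding D_def D2_def by (blast intro: has_derivative_differential)+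
qed

lemma has_derivative_ginv: "(ginv has_derivative differential ginv p) (at p)"
  and continuous_ginv': "continuous_on UNIV (\<lambda>p. differential ginv p h)"
proof -
  have "C_diff (Suc 0) ginv"
    using lie_group by (simp only: lie_group_def smooth_def)
  then show "(ginv has_derivative differential ginv p) (at p)"
    "continuous_on UNIV (\<lambda>p. differential ginv p h)"
    unfolding C_diff.simps by (auto intro: has_derivative_differential)
qed

lemma D2_sym: "D2 z h k = D2 z k h"
  by (rule second_derivative_symmetric[OF has_derivative_D has_derivative_D2 continuous_D2])

lemma linear_D: "linear (D z)"
  by (rule has_derivative_linear[OF has_derivative_D])

lemma linear_D2: "linear (D2 z h)"
  by (rule has_derivative_linear[OF has_derivative_D2])

lemma linear_Pair0: "linear (\<lambda>x. (x, 0))" "linear (\<lambda>x. (0, x))"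
  by (auto intro!: linearI)

lemma has_derivative_left_mul: "(mul a has_derivative (\<lambda>x. D (a, p) (0, x))) (at p)"
proof -
  have "((\<lambda>p. (a, p)) has_derivative (\<lambda>x. (0, x))) (at p)"
    by (auto intro!: derivative_eq_intros)
  from has_derivative_compose[OF this has_derivative_D] show ?thesis by simp
qed

lemma has_derivative_right_mul: "((\<lambda>a. mul a p) has_derivative (\<lambda>x. D (a, p) (x, 0))) (at a)"
proof -
  have "((\<lambda>a. (a, p)) has_derivative (\<lambda>x. (x, 0))) (at a)"
    by (auto intro!: derivative_eq_intros)
  from has_derivative_compose[OF this has_derivative_D] show ?thesis by simp
qed

lemma D_e_left: "D (e, p) (0, x) = x"
proof -
  have "((\<lambda>p. p) has_derivative (\<lambda>x. D (e, p) (0, x))) (at p)"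
    using has_derivative_left_mul[of e p] unfolding ext[of "mul e", OF grp.group_left_neutral] .
  from has_derivative_unique[OF this has_derivative_ident] show ?thesis by meson
qed

lemma D_e_right: "D (p, e) (x, 0) = x"
proof -
  have "((\<lambda>p. p) has_derivative (\<lambda>x. D (p, e) (x, 0))) (at p)"
    using has_derivative_right_mul[of e] by simp
  from has_derivative_unique[OF this has_derivative_ident] show ?thesis by meson
qed

subsection \<open>The Maurer-Cartan form\<close>

text \<open>
  The differential of the left translation that moves \<open>p\<close> to the identity.
\<close>

definition maurer_cartan :: "'a \<Rightarrow> 'a \<Rightarrow> 'a" where
  "maurer_cartan p x = D (ginv p, p) (0, x)"

text \<open>
  The derivative of \<open>q \<mapsto> maurer_cartan q x\<close> at \<open>p\<close> in the direction \<open>h\<close>.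
\<close>

definition maurer_cartan' :: "'a \<Rightarrow> 'a \<Rightarrow> 'a \<Rightarrow> 'a" where
  "maurer_cartan' p h x = D2 (ginv p, p) (0, x) (differential ginv p h, h)"

lemma differential_left_translation: "differential (mul (ginv p)) p = maurer_cartan p"
  unfolding maurer_cartan_def by (rule differential_eqI[OF has_derivative_left_mul])

lemma linear_maurer_cartan: "linear (maurer_cartan p)"
  unfolding maurer_cartan_def
  using linear_compose[OF linear_Pair0(2) linear_D] by (simp add: o_def)

lemma has_derivative_inverse_pair:
  "((\<lambda>p. (ginv p, p)) has_derivative (\<lambda>h. (differential ginv p h, h))) (at p)"
  by (intro has_derivative_Pair has_derivative_ginv has_derivative_ident)

lemma has_derivative_maurer_cartan:
  "((\<lambda>q. maurer_cartan q x) has_derivative (\<lambda>h. maurer_cartan' p h x)) (at p)"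
  unfolding maurer_cartan_def maurer_cartan'_def
  by (rule has_derivative_compose[OF has_derivative_inverse_pair has_derivative_D2])

lemma linear_maurer_cartan': "linear (maurer_cartan' p h)"
  by (rule linear_family_derivative_linear[OF linear_maurer_cartan has_derivative_maurer_cartan])

lemma continuous_maurer_cartan': "continuous_on UNIV (\<lambda>p. maurer_cartan' p h x)"
  unfolding maurer_cartan'_def
proof (rule continuous_on_linear_family[where T = "\<lambda>p. D2 (ginv p, p) (0, x)"])
  have "continuous_on UNIV (\<lambda>p. (ginv p, p))"
    by (intro continuous_at_imp_continuous_on ballI has_derivative_continuous[OF has_derivative_inverse_pair])
  then show "continuous_on UNIV (\<lambda>p. D2 (ginv p, p) (0, x) k)" for k
    by (rule continuous_on_compose2[OF continuous_D2]) simp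
  show "continuous_on UNIV (\<lambda>p. (differential ginv p h, h))"
    by (intro continuous_intros continuous_ginv')
qed (rule linear_D2)

lemma maurer_cartan_left_invariant: "maurer_cartan (mul a p) (D (a, p) (0, x)) = maurer_cartan p x"
proof -
  have eq: "mul (ginv (mul a p)) (mul a q) = mul (ginv p) q" for q
    by (metis grp.assoc grp.left_inverse grp.group_left_neutral grp.right_inverse)
  have "((\<lambda>q. mul (ginv (mul a p)) (mul a q)) has_derivative
      (\<lambda>x. D (ginv (mul a p), mul a p) (0, D (a, p) (0, x)))) (at p)"
    by (rule has_derivative_compose[OF has_derivative_left_mul has_derivative_left_mul])
  from has_derivative_unique[OF this[unfolded eq] has_derivative_left_mul]
  show ?thesis unfolding maurer_cartan_def by meson
qed

lemma maurer_cartan_e: "maurer_cartan e x = x"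
proof -
  have "ginv e = e" by (metis grp.left_inverse grp.right_neutral)
  then show ?thesis by (simp add: maurer_cartan_def D_e_left)
qed

lemma maurer_cartan_left_field: "maurer_cartan p (D (p, e) (0, x)) = x"
  using maurer_cartan_left_invariant[of p e x] by (simp add: maurer_cartan_e)

lemma left_field_maurer_cartan: "D (p, e) (0, maurer_cartan p x) = x"
proof -
  have eq: "mul p (mul (ginv p) q) = q" for q
    by (metis grp.assoc grp.group_left_neutral grp.right_inverse)
  have "((\<lambda>q. mul p (mul (ginv p) q)) has_derivative
      (\<lambda>x. D (p, mul (ginv p) p) (0, D (ginv p, p) (0, x)))) (at p)"
    by (rule has_derivative_compose[OF has_derivative_left_mul has_derivative_left_mul])
  from has_derivative_unique[OF this[unfolded eq] has_derivative_ident]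
  show ?thesis unfolding maurer_cartan_def by (simp add: fun_eq_iff)
qed

subsection \<open>Right-invariant fields\<close>

definition right_field :: "'a \<Rightarrow> 'a \<Rightarrow> 'a" where
  "right_field u p = D (e, p) (u, 0)"

lemma linear_right_field: "linear (\<lambda>u. right_field u p)"
  unfolding right_field_def using linear_compose[OF linear_Pair0(1) linear_D] by (simp add: o_def)

lemma right_field_e: "right_field u e = u"
  by (simp add: right_field_def D_e_right)

lemma has_derivative_right_field:
  "(right_field u has_derivative (\<lambda>x. D2 (e, p) (u, 0) (0, x))) (at p)"
proof -
  have "((\<lambda>p. (e, p)) has_derivative (\<lambda>x. (0, x))) (at p)"
    by (auto intro!: derivative_eq_intros)
  from has_derivative_compose[OF this has_derivative_D2] show ?thesis
    unfolding right_field_def .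
qed

lemmas differential_right_field = differential_eqI[OF has_derivative_right_field]

text \<open>
  Right translation by \<open>p\<close>, whose differential at \<open>e\<close> is \<open>u \<mapsto> right_field u p\<close>, is undone by right
  translation by \<open>ginv p\<close>.
\<close>

lemma right_field_nonzero:
  assumes "right_field u p = 0"
  shows "u = 0"
proof -
  have eq: "mul (mul a p) (ginv p) = a" for a
    by (metis grp.assoc grp.right_inverse grp.right_neutral)
  have "((\<lambda>a. mul (mul a p) (ginv p)) has_derivative
      (\<lambda>x. D (mul e p, ginv p) (D (e, p) (x, 0), 0))) (at e)"
    by (rule has_derivative_compose[OF has_derivative_right_mul has_derivative_right_mul])
  from has_derivative_unique[OF this[unfolded eq] has_derivative_ident]
  have "D (mul e p, ginv p) (right_field u p, 0) = u"
    unfolding right_field_def by meson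
  then show ?thesis using assms linear_0[OF linear_D] by (simp flip: zero_prod_def)
qed

text \<open>
  The Lie derivative of the Maurer-Cartan form along a right-invariant field vanishes, because the
  flow of such a field consists of left translations.  This is \<open>maurer_cartan_left_invariant\<close>
  differentiated in \<open>a\<close> at the identity; all invariance of metric and magnetic form under
  right-invariant fields comes from it.
\<close>

lemma maurer_cartan_lie_derivative:
  "maurer_cartan' p (right_field u p) x + maurer_cartan p (differential (right_field u) p x) = 0"
proof -
  have a: "((\<lambda>q. maurer_cartan q x) has_derivative (\<lambda>h. maurer_cartan' p h x)) (at (mul e p))" for x
    using has_derivative_maurer_cartan by simp
  have "((\<lambda>a. (a, p)) has_derivative (\<lambda>h. (h, 0))) (at e)"
    by (auto intro!: derivative_eq_intros)
  from has_derivative_compose[OF this has_derivative_D2]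
  have b: "((\<lambda>a. D (a, p) (0, x)) has_derivative (\<lambda>h. D2 (e, p) (0, x) (h, 0))) (at e)" .
  have "((\<lambda>a. maurer_cartan (mul a p) (D (a, p) (0, x))) has_derivative
    (\<lambda>h. maurer_cartan' p (D (e, p) (h, 0)) (D (e, p) (0, x))
       + maurer_cartan (mul e p) (D2 (e, p) (0, x) (h, 0)))) (at e)"
    by (rule has_derivative_linear_family[OF linear_maurer_cartan a has_derivative_right_mul b])
  from has_derivative_unique[OF this[unfolded maurer_cartan_left_invariant] has_derivative_const]
  show ?thesis
    unfolding differential_right_field right_field_def D2_sym[of _ "(u, 0)"]
    by (simp add: D_e_left fun_eq_iff)
qed

text \<open>
  By associativity the right translation by \<open>p\<close> maps \<open>R\<^sub>u\<close> at \<open>b\<close> to \<open>R\<^sub>u\<close> at \<open>b p\<close>.  Differentiating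
  this in \<open>b\<close> at the identity along \<open>v\<close> produces a pure second derivative in the left factor, which is symmetric in \<open>u\<close> and \<open>v\<close>, and a
  mixed one; only the mixed one survives antisymmetrization.
\<close>

lemma right_field_bracket:
  "differential (right_field u) p (right_field v p) - differential (right_field v) p (right_field u p)
    = right_field (D2 (e, e) (u, 0) (0, v) - D2 (e, e) (v, 0) (0, u)) p"
proof -
  have eq: "right_field u (mul b p) = D (b, p) (right_field u b, 0)" for u b
  proof -
    have "((\<lambda>a. mul (mul a b) p) has_derivative (\<lambda>x. D (mul e b, p) (D (e, b) (x, 0), 0))) (at e)"
      by (rule has_derivative_compose[OF has_derivative_right_mul has_derivative_right_mul])
    from has_derivative_unique[OF this[unfolded grp.assoc] has_derivative_right_mul]
    show ?thesis unfolding right_field_def by (simp add: fun_eq_iff)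
  qed
  have *: "differential (right_field u) p (right_field v p)
      = D2 (e, p) (u, 0) (v, 0) + right_field (D2 (e, e) (u, 0) (0, v)) p" for u v
  proof -
    have l: "linear (\<lambda>x. D (b, p) (x, 0))" for b
      using linear_compose[OF linear_Pair0(1) linear_D] by (simp add: o_def)
    have "((\<lambda>a. (a, p)) has_derivative (\<lambda>h. (h, 0))) (at e)"
      by (auto intro!: derivative_eq_intros)
    from has_derivative_compose[OF this has_derivative_D2]
    have b: "((\<lambda>b. D (b, p) (x, 0)) has_derivative (\<lambda>h. D2 (e, p) (x, 0) (h, 0))) (at e)" for x .
    have "((\<lambda>b. right_field u (mul b p)) has_derivative
        (\<lambda>h. D2 (e, mul e p) (u, 0) (0, D (e, p) (h, 0)))) (at e)"
      by (rule has_derivative_compose[OF has_derivative_right_mul has_derivative_right_field])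
    moreover have "((\<lambda>b. D (b, p) (right_field u b, 0)) has_derivative
        (\<lambda>h. D2 (e, p) (right_field u e, 0) (h, 0) + D (e, p) (D2 (e, e) (u, 0) (0, h), 0))) (at e)"
      by (rule has_derivative_linear_family[OF l b has_derivative_ident has_derivative_right_field])
    ultimately have "(\<lambda>h. D2 (e, mul e p) (u, 0) (0, D (e, p) (h, 0)))
        = (\<lambda>h. D2 (e, p) (right_field u e, 0) (h, 0) + D (e, p) (D2 (e, e) (u, 0) (0, h), 0))"
      unfolding eq by (rule has_derivative_unique)
    from fun_cong[OF this, of v] show ?thesis
      unfolding differential_right_field by (simp add: right_field_def D_e_right)
  qed
  show ?thesis
    unfolding * linear_diff[OF linear_right_field] using D2_sym[of "(e, p)" "(u, 0)" "(v, 0)"] by simp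
qed

lemma lie_algebra_of_eq:
  "lie_algebra_of mul e u v = D2 (e, e) (u, 0) (0, v) - D2 (e, e) (v, 0) (0, u)"
proof -
  have L: "left_invariant_field mul e u = (\<lambda>p. D (p, e) (0, u))" for u
    unfolding left_invariant_field_def using differential_eqI[OF has_derivative_left_mul] by simp
  have "((\<lambda>p. (p, e)) has_derivative (\<lambda>h. (h, 0))) (at e)"
    by (auto intro!: derivative_eq_intros)
  from differential_eqI[OF has_derivative_compose[OF this has_derivative_D2]]
  have d: "differential (\<lambda>p. D (p, e) (0, u)) e = (\<lambda>h. D2 (e, e) (0, u) (h, 0))" for u .
  show ?thesis
    unfolding lie_algebra_of_def bracket_of_fields_def L d
    by (simp add: D_e_left D2_sym[of _ "(0, _)"])
qed

lemma right_field_lie_bracket: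
  "differential (right_field u) p (right_field v p) - differential (right_field v) p (right_field u p)
    = right_field (lie_algebra_of mul e u v) p"
  unfolding right_field_bracket lie_algebra_of_eq ..

text \<open>
  The Maurer-Cartan form is constant on left-invariant fields; this is the derivative of that
  identity at \<open>e\<close>.  Its skew part is the structure equation.
\<close>

lemma maurer_cartan'_e: "maurer_cartan' e w u = - D2 (e, e) (w, 0) (0, u)"
proof -
  have "((\<lambda>p. (p, e)) has_derivative (\<lambda>h. (h, 0))) (at e)"
    by (auto intro!: derivative_eq_intros)
  from has_derivative_compose[OF this has_derivative_D2]
  have b: "((\<lambda>p. D (p, e) (0, u)) has_derivative (\<lambda>h. D2 (e, e) (0, u) (h, 0))) (at e)" .
  have "((\<lambda>p. maurer_cartan p (D (p, e) (0, u))) has_derivative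
    (\<lambda>h. maurer_cartan' e h (D (e, e) (0, u)) + maurer_cartan e (D2 (e, e) (0, u) (h, 0)))) (at e)"
    by (rule has_derivative_linear_family[OF linear_maurer_cartan has_derivative_maurer_cartan has_derivative_ident b])
  from has_derivative_unique[OF this[unfolded maurer_cartan_left_field] has_derivative_const]
  show ?thesis
    by (simp add: D_e_left maurer_cartan_e D2_sym[of _ "(0, _)"] fun_eq_iff add_eq_0_iff2)
qed

subsection \<open>Left-invariant bilinear forms\<close>

definition left_form :: "('a \<Rightarrow> 'a \<Rightarrow> real) \<Rightarrow> 'a \<Rightarrow> 'a \<Rightarrow> 'a \<Rightarrow> real" where
  "left_form b p u v = b (maurer_cartan p u) (maurer_cartan p v)"

definition left_form' :: "('a \<Rightarrow> 'a \<Rightarrow> real) \<Rightarrow> 'a \<Rightarrow> 'a \<Rightarrow> 'a \<Rightarrow> 'a \<Rightarrow> real" where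
  "left_form' b p h u v = b (maurer_cartan' p h u) (maurer_cartan p v)
     + b (maurer_cartan p u) (maurer_cartan' p h v)"

lemma bilinear_left_form:
  assumes "bilinear b"
  shows "bilinear (left_form b p)"
  unfolding bilinear_def left_form_def
  using linear_compose[OF linear_maurer_cartan, of "b _" p]
    linear_compose[OF linear_maurer_cartan, of "\<lambda>u. b u _" p] assms
  by (auto simp: o_def bilinear_def)

lemma has_derivative_left_form:
  assumes "bilinear b"
  shows "((\<lambda>q. left_form b q u v) has_derivative (\<lambda>h. left_form' b p h u v)) (at p)"
proof -
  have "bounded_bilinear b" using assms by (simp add: bilinear_conv_bounded_bilinear)
  from bounded_bilinear.FDERIV[OF this has_derivative_maurer_cartan has_derivative_maurer_cartan]
  show ?thesis unfolding left_form_def left_form'_def by (simp add: add.commute)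
qed

lemma left_form_lie_derivative:
  assumes "bilinear b"
  shows "left_form' b p (right_field u p) x y + left_form b p (differential (right_field u) p x) y
    + left_form b p x (differential (right_field u) p y) = 0"
proof -
  have *: "maurer_cartan' p (right_field u p) x = - maurer_cartan p (differential (right_field u) p x)" for x
    using maurer_cartan_lie_derivative[of p u x] by (simp add: eq_neg_iff_add_eq_0)
  show ?thesis
    unfolding left_form'_def left_form_def * by (simp add: bilinear_lneg[OF assms] bilinear_rneg[OF assms])
qed

lemma left_form_e: "left_form b e u v = b u v"
  by (simp add: left_form_def maurer_cartan_e)

text \<open>
  The regularity that Poincare's lemma requires of the 1-form obtained by contracting a
  left-invariant form with a right-invariant field.
\<close>

lemma contraction_continuously_differentiable:
  assumes b: "bilinear b"
  shows "((\<lambda>q. left_form b q (right_field u q) w) has_derivative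
      (\<lambda>h. left_form' b p h (right_field u p) w + left_form b p (differential (right_field u) p h) w)) (at p)"
    and "continuous_on UNIV (\<lambda>p. left_form' b p h (right_field u p) w
       + left_form b p (differential (right_field u) p h) w)"
proof -
  have l: "linear (\<lambda>x. left_form b p x w)" for p
    using bilinear_left_form[OF b] by (simp add: bilinear_def)
  show "((\<lambda>q. left_form b q (right_field u q) w) has_derivative
      (\<lambda>h. left_form' b p h (right_field u p) w + left_form b p (differential (right_field u) p h) w)) (at p)"
    unfolding differential_right_field
    by (rule has_derivative_linear_family[where T="\<lambda>q x. left_form b q x w" and c="\<lambda>q. q",
          OF l has_derivative_left_form[OF b] has_derivative_ident has_derivative_right_field])
  have cb: "continuous_on UNIV (\<lambda>p. b (X p) (Y p))"
    if "continuous_on UNIV X" "continuous_on UNIV Y" for X Y :: "'a \<Rightarrow> 'a"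
    using bounded_bilinear.continuous_on[OF b[unfolded bilinear_conv_bounded_bilinear] that] .
  have A: "continuous_on UNIV (\<lambda>p. maurer_cartan p x)" for x
    by (intro continuous_at_imp_continuous_on ballI has_derivative_continuous[OF has_derivative_maurer_cartan])
  have R: "continuous_on UNIV (right_field u)"
    by (intro continuous_at_imp_continuous_on ballI has_derivative_continuous[OF has_derivative_right_field])
  have R': "continuous_on UNIV (\<lambda>p. differential (right_field u) p h)"
    unfolding differential_right_field
    by (rule continuous_on_compose2[OF continuous_D2]) (auto intro!: continuous_intros)
  show "continuous_on UNIV (\<lambda>p. left_form' b p h (right_field u p) w
       + left_form b p (differential (right_field u) p h) w)"
    unfolding left_form'_def left_form_def
    by (intro continuous_on_add cb A continuous_maurer_cartan'
        continuous_on_linear_family[OF linear_maurer_cartan A] R R'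
        continuous_on_linear_family[OF linear_maurer_cartan' continuous_maurer_cartan' R])
qed

lemma left_invariant_metric_eq: "left_invariant_metric mul ginv = left_form inner"
  by (intro ext) (simp add: left_invariant_metric_def left_form_def differential_left_translation)

lemma bilinear_inner: "bilinear (inner :: 'a \<Rightarrow> 'a \<Rightarrow> real)"
  using bounded_bilinear_inner by (simp add: bilinear_conv_bounded_bilinear)

lemma riemannian_metric_left_invariant: "riemannian_metric (left_invariant_metric mul ginv)"
  unfolding left_invariant_metric_eq
proof
  show "left_form inner p u v = left_form inner p v u" for p u v
    by (simp add: left_form_def inner_commute)
  show "0 < left_form inner p u u" if "u \<noteq> 0" for p u
    using that left_field_maurer_cartan[of p u] linear_0[OF linear_D]
    by (auto simp: left_form_def simp flip: zero_prod_def)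
  show "(\<lambda>q. left_form inner q u v) differentiable at p" for p u v
    using has_derivative_left_form[OF bilinear_inner] by (auto simp: differentiable_def)
qed (rule bilinear_left_form[OF bilinear_inner])

end

subsection \<open>Left-invariant Lorentz forces\<close>

locale lie_group_lorentz = lie_group_chart +
  fixes F :: "'a \<Rightarrow> 'a \<Rightarrow> 'a"
  assumes lorentz: "lorentz_force (left_invariant_metric mul ginv) F"
    and left_invariant: "left_invariant_endomorphism mul F"
begin

sublocale magnetic_system "left_invariant_metric mul ginv" F
  using riemannian_metric_left_invariant lorentz
  by (simp add: magnetic_system_def magnetic_system_axioms_def)

lemma linear_F: "linear (F p)"
  using lorentz by (simp add: lorentz_force_def)

definition \<omega>\<^sub>e :: "'a \<Rightarrow> 'a \<Rightarrow> real" where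
  "\<omega>\<^sub>e u v = F e u \<bullet> v"

lemma bilinear_\<omega>\<^sub>e: "bilinear \<omega>\<^sub>e"
  unfolding bilinear_def \<omega>\<^sub>e_def
  by (auto intro!: linearI simp: linear_add[OF linear_F] linear_scale[OF linear_F] inner_simps)

text \<open>
  A left-invariant endomorphism is determined by its value at the identity, so \<open>\<omega>\<close> is the
  left-invariant form with value \<open>\<omega>\<^sub>e\<close>.
\<close>

lemma \<omega>_eq: "\<omega> = left_form \<omega>\<^sub>e"
proof (intro ext)
  fix p u v
  have "maurer_cartan p (F p u) = F (mul (ginv p) p) (maurer_cartan p u)"
    using left_invariant unfolding left_invariant_endomorphism_def differential_left_translation[symmetric]
    by blast
  then show "\<omega> p u v = left_form \<omega>\<^sub>e p u v"
    unfolding \<omega>_def unfolding left_invariant_metric_eq by (simp add: left_form_def \<omega>\<^sub>e_def)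
qed

lemma \<omega>\<^sub>e_skew: "\<omega>\<^sub>e u v = - \<omega>\<^sub>e v u"
  using \<omega>_skew[of e u v] by (simp add: \<omega>_eq left_form_e)

lemma \<omega>_closed:
  "left_form' \<omega>\<^sub>e p u v w - left_form' \<omega>\<^sub>e p v u w + left_form' \<omega>\<^sub>e p w u v = 0"
proof -
  have "exterior_derivative2 (left_form \<omega>\<^sub>e) p u v w = 0"
    using lorentz unfolding lorentz_force_def \<omega>_eq[symmetric] \<omega>_def by blast
  then show ?thesis
    by (simp add: exterior_derivative2_def differential_eqI[OF has_derivative_left_form[OF bilinear_\<omega>\<^sub>e]])
qed

text \<open>
  Closedness of \<open>\<omega>\<close> at the identity, read on left-invariant fields.
\<close>

lemma \<omega>\<^sub>e_cocycle:
  "\<omega>\<^sub>e (lie_algebra_of mul e u v) w + \<omega>\<^sub>e (lie_algebra_of mul e v w) u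
     + \<omega>\<^sub>e (lie_algebra_of mul e w u) v = 0"
proof -
  note bs = bilinear_lsub[OF bilinear_\<omega>\<^sub>e] bilinear_lneg[OF bilinear_\<omega>\<^sub>e] bilinear_rneg[OF bilinear_\<omega>\<^sub>e]
  show ?thesis
    using \<omega>_closed[of e u v w] \<omega>\<^sub>e_skew[of v "D2 (e, e) (u, 0) (0, w)"]
      \<omega>\<^sub>e_skew[of u "D2 (e, e) (v, 0) (0, w)"] \<omega>\<^sub>e_skew[of u "D2 (e, e) (w, 0) (0, v)"]
    by (simp add: left_form'_def maurer_cartan_e maurer_cartan'_e lie_algebra_of_eq bs)
qed

lemma left_form_skew: "left_form \<omega>\<^sub>e p u v = - left_form \<omega>\<^sub>e p v u"
  unfolding left_form_def by (rule \<omega>\<^sub>e_skew)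

text \<open>
  By Cartan's formula \<open>d(\<omega>(R, \<cdot>))\<close> is the Lie derivative of \<open>\<omega>\<close> along \<open>R\<close> minus \<open>d\<omega>\<close> contracted
  with \<open>R\<close>.  Both vanish, so the contraction has a primitive.
\<close>

lemma right_field_symmetry:
  obtains f where "infinitesimal_symmetry (right_field u) f"
proof -
  have dg: "dg p h x y = left_form' inner p h x y" for p h x y
    unfolding dg_def unfolding left_invariant_metric_eq
    by (simp add: differential_eqI[OF has_derivative_left_form[OF bilinear_inner]])
  obtain f where f: "\<And>p. (f has_derivative (\<lambda>w. left_form \<omega>\<^sub>e p (right_field u p) w)) (at p)"
  proof (rule closed_one_form_exact)
    show "linear (\<lambda>w. left_form \<omega>\<^sub>e p (right_field u p) w)" for p
      using bilinear_left_form[OF bilinear_\<omega>\<^sub>e] by (simp add: bilinear_def)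
    show "left_form' \<omega>\<^sub>e p h (right_field u p) w + left_form \<omega>\<^sub>e p (differential (right_field u) p h) w
      = left_form' \<omega>\<^sub>e p w (right_field u p) h + left_form \<omega>\<^sub>e p (differential (right_field u) p w) h" for p h w
      using left_form_lie_derivative[OF bilinear_\<omega>\<^sub>e, of p u h w] \<omega>_closed[of p "right_field u p" h w]
        left_form_skew[of p h "differential (right_field u) p w"] by simp
  qed ((rule contraction_continuously_differentiable[OF bilinear_\<omega>\<^sub>e])+, blast)
  have "infinitesimal_symmetry (right_field u) f"
    unfolding infinitesimal_symmetry_def dg \<omega>_eq unfolding left_invariant_metric_eq
  proof (intro conjI allI)
    show "right_field u differentiable at p" for p
      using has_derivative_right_field by (auto simp: differentiable_def)
    show "left_form' inner p (right_field u p) v w + left_form inner p (differential (right_field u) p v) w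
      + left_form inner p v (differential (right_field u) p w) = 0" for p v w
      by (rule left_form_lie_derivative[OF bilinear_inner])
    show "(f has_derivative left_form \<omega>\<^sub>e p (right_field u p)) (at p)" for p
      by (rule f)
  qed
  then show ?thesis by (rule that)
qed

text \<open>
  For two fields that preserve a closed form, the differential of \<open>\<omega>(R\<^sub>u, R\<^sub>v)\<close> is up to sign the
  contraction of \<open>\<omega>\<close> with their bracket; so this function is constant when the fields commute.
\<close>

lemma \<omega>_right_fields:
  assumes "lie_algebra_of mul e u v = 0"
  shows "\<omega> p (right_field u p) (right_field v p) = \<omega>\<^sub>e u v"
proof -
  let ?R = "right_field u" and ?S = "right_field v"
  have comm: "differential ?R p (?S p) = differential ?S p (?R p)" for p
    using right_field_lie_bracket[of u p v] assms by (simp add: linear_0[OF linear_right_field])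
  have "((\<lambda>p. left_form \<omega>\<^sub>e p (?R p) (?S p)) has_derivative (\<lambda>h. 0)) (at p)" for p
  proof -
    have R: "(right_field u has_derivative differential (right_field u) p) (at p)" for u
      unfolding differential_right_field by (rule has_derivative_right_field)
    have "((\<lambda>p. left_form \<omega>\<^sub>e p (?R p) (?S p)) has_derivative (\<lambda>h. left_form' \<omega>\<^sub>e p h (?R p) (?S p)
        + left_form \<omega>\<^sub>e p (differential ?R p h) (?S p) + left_form \<omega>\<^sub>e p (?R p) (differential ?S p h))) (at p)"
      by (rule has_derivative_bilinear_family[OF bilinear_left_form[OF bilinear_\<omega>\<^sub>e]
          has_derivative_left_form[OF bilinear_\<omega>\<^sub>e] has_derivative_ident R R])
    moreover have "left_form' \<omega>\<^sub>e p h (?R p) (?S p) + left_form \<omega>\<^sub>e p (differential ?R p h) (?S p)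
        + left_form \<omega>\<^sub>e p (?R p) (differential ?S p h) = 0" for h
      using left_form_lie_derivative[OF bilinear_\<omega>\<^sub>e, of p u "?S p" h]
        left_form_lie_derivative[OF bilinear_\<omega>\<^sub>e, of p v "?R p" h]
        \<omega>_closed[of p "?R p" "?S p" h] comm[of p]
        left_form_skew[of p "?S p" "differential ?R p h"]
      by simp
    ultimately show ?thesis by simp
  qed
  then obtain c where "\<And>p. left_form \<omega>\<^sub>e p (?R p) (?S p) = c"
    using has_derivative_zero_constant[of UNIV "\<lambda>p. left_form \<omega>\<^sub>e p (?R p) (?S p)"] by auto
  from this[of p] this[of e] show ?thesis
    by (simp add: \<omega>_eq left_form_e right_field_e)
qed

text \<open>
  The vectors \<open>u i\<close> form a basis of an abelian hyperplane on which \<open>\<omega>\<^sub>e\<close> vanishes.  The associated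
  right-invariant fields commute, are \<open>\<omega>\<close>-orthogonal everywhere, and stay independent because
  right translations are diffeomorphisms.
\<close>

theorem isotropic_abelian_hyperplane_integrable:
  fixes u :: "nat \<Rightarrow> 'a"
  defines "J \<equiv> {1..DIM('a) - 1}"
  assumes abelian: "\<And>i j. i \<in> J \<Longrightarrow> j \<in> J \<Longrightarrow> lie_algebra_of mul e (u i) (u j) = 0"
    and isotropic: "\<And>i j. i \<in> J \<Longrightarrow> j \<in> J \<Longrightarrow> \<omega>\<^sub>e (u i) (u j) = 0"
    and indep: "\<And>c. (\<Sum>i\<in>J. c i *\<^sub>R u i) = 0 \<Longrightarrow> \<forall>i\<in>J. c i = 0"
  shows "completely_integrable (left_invariant_metric mul ginv) F"
proof -
  have "\<exists>f. \<forall>i. infinitesimal_symmetry (right_field (u i)) (f i)"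
    by (rule choice) (metis right_field_symmetry)
  then obtain f where f: "\<And>i. infinitesimal_symmetry (right_field (u i)) (f i)" by blast
  show ?thesis
  proof (rule commuting_symmetries_integrable[where R="\<lambda>i. right_field (u i)" and f=f, folded J_def])
    show "infinitesimal_symmetry (right_field (u i)) (f i)" for i by (rule f)
    fix i j p assume ij: "i \<in> J" "j \<in> J"
    show "differential (right_field (u i)) p (right_field (u j) p)
      = differential (right_field (u j)) p (right_field (u i) p)"
      using right_field_lie_bracket[of "u i" p "u j"] abelian[OF ij] by (simp add: linear_0[OF linear_right_field])
    show "\<omega> p (right_field (u i) p) (right_field (u j) p) = 0"
      using \<omega>_right_fields abelian isotropic ij by simp
  next
    fix p c assume "(\<Sum>i\<in>J. c i *\<^sub>R right_field (u i) p) = 0"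
    then have "right_field (\<Sum>i\<in>J. c i *\<^sub>R u i) p = 0"
      by (simp add: linear_sum[OF linear_right_field] linear_scale[OF linear_right_field])
    then show "\<forall>i\<in>J. c i = 0" using right_field_nonzero indep by blast
  qed
qed

end

section \<open>Isotropic abelian hyperplanes in dimension four\<close>

lemma plane_spanned_by:
  fixes K :: "'a::euclidean_space set"
  assumes "subspace K" "dim K = 2" "k \<in> K" "c \<in> K" "c \<noteq> 0" "k \<notin> span {c}"
  shows "K = span {k, c}"
proof -
  have "independent {k, c}" "k \<noteq> c"
    using assms(5,6) by (auto simp: independent_insert span_base)
  then have "K \<subseteq> span {k, c}"
    using assms by (intro card_ge_dim_independent) auto
  moreover have "span {k, c} \<subseteq> K"
    using assms by (intro span_minimal) auto
  ultimately show ?thesis by blast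
qed

text \<open>
  The kernel of a skew map is the orthogonal complement of its range.
\<close>

lemma dim_kernel_skew:
  fixes T :: "'a::euclidean_space \<Rightarrow> 'a"
  assumes T: "linear T" and skew: "\<And>u v. T u \<bullet> v = - u \<bullet> T v"
  shows "subspace {x. T x = 0}" and "dim {x. T x = 0} + dim (range T) = DIM('a)"
proof -
  show "subspace {x. T x = 0}"
    using T by (rule linear_subspace_kernel)
  have "T y = 0 \<longleftrightarrow> (\<forall>x. T x \<bullet> y = 0)" for y
  proof
    assume "\<forall>x. T x \<bullet> y = 0"
    then have "T (T y) \<bullet> y = 0" by blast
    then have "T y \<bullet> T y = 0"
      using skew[of y "T y"] inner_commute[of y "T (T y)"] by simp
    then show "T y = 0" by simp
  next
    assume "T y = 0"
    then show "\<forall>x. T x \<bullet> y = 0" using skew[of _ y] by simp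
  qed
  then have "{x. T x = 0} = {y \<in> UNIV. \<forall>x\<in>range T. orthogonal x y}"
    by (simp add: orthogonal_def)
  then show "dim {x. T x = 0} + dim (range T) = DIM('a)"
    using dim_subspace_orthogonal_to_vectors[of "range T" UNIV] linear_subspace_image[OF T subspace_UNIV]
    by simp
qed

text \<open>
  The hyperplane is spanned by the plane \<open>K = ker T\<close> and a vector \<open>x \<notin> K\<close> that commutes with \<open>K\<close>.

  The cocycle identity makes \<open>K\<close> a subalgebra, and a 2-dimensional nilpotent Lie algebra is abelian.

  Suppose that \<open>K\<close> contains its own centralizer.  Then \<open>K\<close> contains the centre, hence all brackets,
  but is not central itself, for otherwise it would be the whole space.  A noncentral \<open>k \<in> K\<close> and a nonzero bracket \<open>c = [k, y]\<close> span \<open>K\<close>, and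
  every \<open>[k, x]\<close> is a multiple \<open>t c\<close> of \<open>c\<close>, being a central element of \<open>K\<close>.  So \<open>x - t y\<close> commutes
  with \<open>k\<close> and with the central \<open>c\<close>, hence lies in \<open>K\<close>: the three vectors \<open>k\<close>, \<open>c\<close>, \<open>y\<close> span a space
  of dimension four.
\<close>

lemma exists_isotropic_abelian_hyperplane:
  fixes br :: "'a::euclidean_space \<Rightarrow> 'a \<Rightarrow> 'a" and T :: "'a \<Rightarrow> 'a"
  assumes alg: "lie_algebra br" and nil: "two_step_nilpotent br" and dim4: "DIM('a) = 4"
    and T: "linear T" and skew: "\<And>u v. T u \<bullet> v = - u \<bullet> T v"
    and cocycle: "\<And>u v w. T (br u v) \<bullet> w + T (br v w) \<bullet> u + T (br w u) \<bullet> v = 0"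
    and rank: "dim (range T) = 2"
  obtains u :: "nat \<Rightarrow> 'a" where
    "\<And>i j. i \<in> {1..3} \<Longrightarrow> j \<in> {1..3} \<Longrightarrow> br (u i) (u j) = 0"
    "\<And>i j. i \<in> {1..3} \<Longrightarrow> j \<in> {1..3} \<Longrightarrow> T (u i) \<bullet> u j = 0"
    "\<And>c. (\<Sum>i\<in>{1..3}. c i *\<^sub>R u i) = 0 \<Longrightarrow> \<forall>i\<in>{1..3}. c i = 0"
proof -
  have bl: "bilinear br" and alt: "\<And>u. br u u = 0"
    using alg by (auto simp: lie_algebra_def)
  note bs = bilinear_ladd[OF bl] bilinear_radd[OF bl] bilinear_lmul[OF bl] bilinear_rmul[OF bl]
    bilinear_lsub[OF bl] bilinear_rsub[OF bl] bilinear_lzero[OF bl] bilinear_rzero[OF bl]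
  have nil1: "br u (br v w) = 0" for u v w
    using nil by (simp add: two_step_nilpotent_def)
  have anti: "br u v = - br v u" for u v
    using alt[of "u + v"] alt[of u] alt[of v] by (simp add: bs eq_neg_iff_add_eq_0 add.commute)
  have nil2: "br (br v w) u = 0" for u v w
    using anti[of "br v w" u] nil1 by simp
  define K where "K = {x. T x = 0}"
  have K: "subspace K" "dim K = 2"
    using dim_kernel_skew[OF T skew] rank dim4 by (auto simp: K_def)
  have orth: "T u \<bullet> k = 0" if "k \<in> K" for u k
    using that skew by (simp add: K_def)
  have K_abelian: "br a b = 0" if a: "a \<in> K" and b: "b \<in> K" for a b
  proof (rule ccontr)
    assume ne: "br a b \<noteq> 0"
    have "T (br a b) \<bullet> w = 0" for w
      using cocycle[of a b w] orth[OF a] orth[OF b] by simp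
    then have c: "br a b \<in> K" unfolding K_def using inner_eq_zero_iff by blast
    have "a \<notin> span {br a b}"
    proof
      assume "a \<in> span {br a b}"
      then obtain t where "a = t *\<^sub>R br a b" by (auto simp: span_singleton)
      then have "br a b = br (t *\<^sub>R br a b) b" by simp
      then show False using ne by (simp add: bs nil2)
    qed
    then have "b \<in> span {a, br a b}" using plane_spanned_by[OF K a c ne] b by simp
    then obtain s t where "b = s *\<^sub>R a + t *\<^sub>R br a b"
      by (auto simp: span_breakdown_eq span_singleton algebra_simps)
    then have "br a b = br a (s *\<^sub>R a + t *\<^sub>R br a b)" by simp
    also have "\<dots> = 0" by (simp add: bs alt nil1)
    finally show False using ne by simp
  qed
  have "\<exists>x. x \<notin> K \<and> (\<forall>k\<in>K. br x k = 0)"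
  proof (rule ccontr)
    assume "\<not> ?thesis"
    then have centralizer: "x \<in> K" if "\<And>k. k \<in> K \<Longrightarrow> br x k = 0" for x
      using that by blast
    have "K \<noteq> UNIV" using K(2) dim4 by auto
    then obtain k z where k: "k \<in> K" "br z k \<noteq> 0" using centralizer by blast
    \<comment> \<open>the sign turns \<open>[z, k] \<noteq> 0\<close> into a bracket with \<open>k\<close> on the left\<close>
    define y c where "y = - z" and "c = br k y"
    have c: "c \<in> K" "c \<noteq> 0" and central: "br x c = 0" "br c x = 0" for x
      using k anti[of k z] by (auto simp: c_def y_def nil1 nil2 bilinear_rneg[OF bl] intro!: centralizer)
    have kc: "k \<notin> span {c}"
      using k(2) central by (auto simp: span_singleton bs)
    have Kspan: "K = span {k, c}" by (rule plane_spanned_by[OF K k(1) c kc])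
    have "x \<in> span {k, c, y}" for x
    proof -
      have "br k x \<in> span {k, c}"
        unfolding Kspan[symmetric] by (rule centralizer) (rule nil2)
      then obtain s t where st: "br k x = s *\<^sub>R k + t *\<^sub>R c"
        by (auto simp: span_breakdown_eq span_singleton algebra_simps)
      have "s *\<^sub>R br z k = br z (br k x)" unfolding st by (simp add: bs central)
      then have "s = 0" using k(2) by (simp add: nil1)
      with st have *: "br k (x - t *\<^sub>R y) = 0" by (simp add: bs c_def)
      have "x - t *\<^sub>R y \<in> K"
      proof (rule centralizer)
        fix w assume "w \<in> K"
        then obtain a b where "w = a *\<^sub>R k + b *\<^sub>R c"
          unfolding Kspan by (auto simp: span_breakdown_eq span_singleton algebra_simps)
        then show "br (x - t *\<^sub>R y) w = 0"
          using * anti[of "x - t *\<^sub>R y" k] by (simp only: bs central) simp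
      qed
      then have "x - t *\<^sub>R y \<in> span {k, c, y}"
        unfolding Kspan by (rule rev_subsetD) (rule span_mono, auto)
      then have "(x - t *\<^sub>R y) + t *\<^sub>R y \<in> span {k, c, y}"
        by (rule span_add) (rule span_scale, rule span_base, simp)
      then show ?thesis by simp
    qed
    then have "dim (UNIV :: 'a set) \<le> card {k, c, y}" by (intro dim_le_card) auto
    also have "\<dots> \<le> 3" by (simp add: card_insert_if)
    finally show False using dim4 by simp
  qed
  then obtain x where x: "x \<notin> K" "\<And>k. k \<in> K \<Longrightarrow> br x k = 0" by blast
  obtain B where B: "B \<subseteq> K" "independent B" "card B = 2"
    using basis_exists[of K] K(2) by metis
  then obtain k l where kl: "B = {k, l}" "k \<noteq> l" by (auto simp: card_2_iff)
  have kK: "k \<in> K" "l \<in> K" using B kl by auto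
  define u :: "nat \<Rightarrow> 'a" where "u i = (if i = 1 then k else if i = 2 then l else x)" for i
  have J: "{1..3} = {1, 2, 3::nat}" by auto
  show ?thesis
  proof (rule that[of u])
    have xk: "br k x = 0" if "k \<in> K" for k using x(2)[OF that] anti[of k x] by simp
    show "br (u i) (u j) = 0" if "i \<in> {1..3}" "j \<in> {1..3}" for i j
      using kK K_abelian x(2) xk alt by (simp add: u_def)
    have "T x \<bullet> x = 0" using skew[of x x] by (simp add: inner_commute)
    then show "T (u i) \<bullet> u j = 0" if "i \<in> {1..3}" "j \<in> {1..3}" for i j
      using kK orth by (auto simp: u_def K_def)
    fix c :: "nat \<Rightarrow> real" assume "(\<Sum>i\<in>{1..3}. c i *\<^sub>R u i) = 0"
    then have 0: "c 1 *\<^sub>R k + c 2 *\<^sub>R l + c 3 *\<^sub>R x = 0" unfolding J by (simp add: u_def add.assoc)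
    have c3: "c 3 = 0"
    proof (rule ccontr)
      assume ne: "c 3 \<noteq> 0"
      from 0 have "c 3 *\<^sub>R x = - (c 1 *\<^sub>R k + c 2 *\<^sub>R l)" by (simp only: eq_neg_iff_add_eq_0 add.commute)
      also have "\<dots> \<in> K" using kK K(1) by (intro subspace_neg subspace_add subspace_scale)
      finally have "(1 / c 3) *\<^sub>R (c 3 *\<^sub>R x) \<in> K" by (rule subspace_scale[OF K(1)])
      then show False using ne x(1) by simp
    qed
    have "(\<Sum>v\<in>B. (if v = k then c 1 else c 2) *\<^sub>R v) = 0"
      using 0 c3 kl by simp
    from independentD[OF B(2) _ _ this] have "\<And>v. v \<in> B \<Longrightarrow> (if v = k then c 1 else c 2) = 0"
      using kl by blast
    from this[of k] this[of l] have "c 1 = 0" "c 2 = 0" using kl by auto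
    with c3 show "\<forall>i\<in>{1..3}. c i = 0" unfolding J by simp
  qed
qed

section \<open>Magnetic flows of rank two\<close>

theorem proposition4p4:
  fixes br mul :: "'n::euclidean_space \<Rightarrow> 'n \<Rightarrow> 'n"
    and e :: 'n
    and ginv :: "'n \<Rightarrow> 'n"
    and F :: "'n \<Rightarrow> 'n \<Rightarrow> 'n"
  assumes "lie_algebra br"
    and "two_step_nilpotent br"
    and "DIM('n) = 4"
    and "lie_group mul e ginv"
    and "lie_algebra_of mul e = br"
    and "lorentz_force (left_invariant_metric mul ginv) F"
    and "left_invariant_endomorphism mul F"
    and "\<forall>p. dim (range (F p)) = 2"
  shows "completely_integrable (left_invariant_metric mul ginv) F"
proof -
  interpret lie_group_lorentz mul e ginv F
    using assms by unfold_locales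
  have skew: "F e u \<bullet> v = - u \<bullet> F e v" for u v
    using \<omega>\<^sub>e_skew[of u v] by (simp add: \<omega>\<^sub>e_def inner_commute)
  have cocycle: "F e (br u v) \<bullet> w + F e (br v w) \<bullet> u + F e (br w u) \<bullet> v = 0" for u v w
    using \<omega>\<^sub>e_cocycle[of u v w] by (simp add: \<omega>\<^sub>e_def assms(5))
  obtain u :: "nat \<Rightarrow> 'n" where
    "\<And>i j. i \<in> {1..3} \<Longrightarrow> j \<in> {1..3} \<Longrightarrow> br (u i) (u j) = 0"
    "\<And>i j. i \<in> {1..3} \<Longrightarrow> j \<in> {1..3} \<Longrightarrow> F e (u i) \<bullet> u j = 0"
    "\<And>c. (\<Sum>i\<in>{1..3}. c i *\<^sub>R u i) = 0 \<Longrightarrow> \<forall>i\<in>{1..3}. c i = 0"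
    by (rule exists_isotropic_abelian_hyperplane[OF assms(1,2,3) linear_F skew cocycle assms(8)[rule_format]])
      blast
  then show ?thesis
    by (intro isotropic_abelian_hyperplane_integrable[of u]) (simp_all add: assms(3,5) \<omega>\<^sub>e_def)
qed

end
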